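(* Let $\operatorname{T}(X)$ denote the number of domino tilings of a region $X$, and let $R(n)$, $K_a(n)$, $K_{na}(n)$ be the quartered Aztec diamonds of order $n$ defined in the context. Then: (i) for every integer $n\ge 0$, $\operatorname{T}(R(4n+1))=\operatorname{T}(R(4n+2))=0$; and for every integer $n\ge 1$: (ii) $\displaystyle \operatorname{T}(R(4n))=2^n\operatorname{T}(R(4n-1))=2^{n(3n-1)/2}\prod_{1\le i<j\le n}\frac{2i+2j-1}{i+j-1}$; (iii) $\displaystyle \operatorname{T}(K_a(4n-2))=\operatorname{T}(K_a(4n))=2^{n(3n-1)/2}\prod_{1\le i<j\le n}\frac{2i+2j-3}{i+j-1}$; (iv) $\displaystyle \operatorname{T}(K_a(4n-1))=\operatorname{T}(K_a(4n+1))=2^{n(3n-3)/2}\prod_{1\le i\le j\le n}\frac{2i+2j-1}{i+j-1}$; (v) $\displaystyle \operatorname{T}(K_{na}(4n))=\operatorname{T}(K_{na}(4n+2))=2^{n(3n-1)/2}\prod_{1\le i\le j\le n}\frac{2i+2j-1}{i+j-1}$; (vi) $\displaystyle \operatorname{T}(K_{na}(4n-3))=\operatorname{T}(K_{na}(4n-1))=2^{n(3n-3)/2}\prod_{1\le i<j\le n}\frac{2i+2j-3}{i+j-1}$. (Empty products equal $1$.)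
   Context: A domino is the union of two unit squares of the square lattice sharing an edge; a (domino) tiling of a region (a finite union of lattice unit squares) is a covering of it by dominoes without gaps or overlaps; $\operatorname{T}(X)$ is the number of tilings of $X$ (the empty region has exactly one tiling). For integers $a,b$ let $S_{a,b}=[a,a+1]\times[b,b+1]$. The Aztec diamond of order $n$ is the union of the squares $S_{a,b}$ with $|a+\tfrac12|+|b+\tfrac12|\le n$ (equivalently, all four corners $(x,y)$ satisfy $|x|+|y|\le n+1$). Quartered Aztec diamonds are the four pieces obtained by cutting the Aztec diamond of order $n$ along two zigzag lattice paths with steps of length 2 passing through its center; explicitly: $R(n)$ is the union of the squares $S_{a,b}$ of the Aztec diamond of order $n$ with $b\ge 2\lceil a/2\rceil$ and $a\ge -2\lceil b/2\rceil$ (the pieces for the fourfold rotationally symmetric pair of cuts); the abutting quartered Aztec diamond $K_a(n)$ is the union of the squares $S_{a,b}$ of the Aztec diamond of order $n$ with $b\ge 2\,|\lceil a/2\rceil|$; the non-abutting quartered Aztec diamond $K_{na}(n)$ is the union of the squares $S_{a,b}$ of the Aztec diamond of order $n$ with $-2\lceil a/2\rceil\le b\le 2\lceil a/2\rceil-1$ (the last two being pieces for the reflection-symmetric pair of cuts). *)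

theory Defs
  imports Complex_Main "HOL-Library.Disjoint_Sets"
begin

text \<open>The unit square \<open>S\<^bsub>a,b\<^esub> = [a,a+1] \<times> [b,b+1]\<close> is encoded by its lower left corner
  \<open>(a,b)\<close>, and a region, i.e. a finite union of such squares, by the set of its squares.\<close>

type_synonym cell = "int \<times> int"
type_synonym region = "cell set"

definition domino :: "region \<Rightarrow> bool" where
  "domino d \<longleftrightarrow> (\<exists>a b. d = {(a, b), (a + 1, b)} \<or> d = {(a, b), (a, b + 1)})"

definition domino_tiling :: "region \<Rightarrow> region set \<Rightarrow> bool" where
  "domino_tiling X D \<longleftrightarrow> (\<forall>d\<in>D. domino d) \<and> disjoint D \<and> \<Union>D = X"

definition num_tilings :: "region \<Rightarrow> nat" where
  "num_tilings X = card {D. domino_tiling X D}"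

definition aztec_diamond :: "nat \<Rightarrow> region" where
  "aztec_diamond n =
     {(a, b). \<bar>real_of_int a + 1 / 2\<bar> + \<bar>real_of_int b + 1 / 2\<bar> \<le> real n}"

definition quartered_R :: "nat \<Rightarrow> region" where
  "quartered_R n =
     {(a, b) \<in> aztec_diamond n.
        b \<ge> 2 * \<lceil>real_of_int a / 2\<rceil> \<and> a \<ge> - 2 * \<lceil>real_of_int b / 2\<rceil>}"

definition quartered_Ka :: "nat \<Rightarrow> region" where
  "quartered_Ka n =
     {(a, b) \<in> aztec_diamond n. b \<ge> 2 * \<bar>\<lceil>real_of_int a / 2\<rceil>\<bar>}"

definition quartered_Kna :: "nat \<Rightarrow> region" where
  "quartered_Kna n =
     {(a, b) \<in> aztec_diamond n.
        - 2 * \<lceil>real_of_int a / 2\<rceil> \<le> b \<and> b \<le> 2 * \<lceil>real_of_int a / 2\<rceil> - 1}"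

definition pairs_lt :: "nat \<Rightarrow> (nat \<times> nat) set" where
  "pairs_lt n = {(i, j). 1 \<le> i \<and> i < j \<and> j \<le> n}"

definition pairs_le :: "nat \<Rightarrow> (nat \<times> nat) set" where
  "pairs_le n = {(i, j). 1 \<le> i \<and> i \<le> j \<and> j \<le> n}"

end

theory Submission
  imports Defs "Jordan_Normal_Form.Determinant"
begin

text \<open>Cut a quartered Aztec diamond into the diagonals \<open>a + b = c\<close> and describe a cell by \<open>c\<close> and
  \<open>x = b - a\<close>; dominoes join \<open>(c, x)\<close> to \<open>(c + 1, x \<plusminus> 1)\<close>. The region lies between the
  line \<open>x = n\<close> and a wall that oscillates around \<open>x = 1\<close> with period four in \<open>c\<close>. A tiling is
  determined by the set of cells of each diagonal that are matched upwards. On every second diagonal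
  this set is small (particles), on the others its complement is small (holes). Passing from holes on
  one diagonal to particles on the next moves each of them by \<open>\<plusminus>1\<close>, passing from particles to
  holes replaces a configuration by an interlacing one.

  The number of tilings above a given configuration is, up to a constant, the alternant
  \<open>det (x\<^sub>i\<^bsup>2j+e\<^esup>)\<close> with \<open>e \<in> {0, 1}\<close>. Both transitions are sums of alternants over a box,
  hence determinants of termwise sums: \<open>(y - 1)\<^sup>k + (y + 1)\<^sup>k\<close> in the first case, and, as
  \<open>(y + 1)\<^sup>k - (y - 1)\<^sup>k\<close> telescopes, differences of powers in the second. Triangularity turns them back
  into alternants, with \<open>e\<close> flipped by each interlacing step. The zigzag cut at the bottom prescribes
  the last configuration to be \<open>1, 5, 9, \<dots>\<close> or \<open>3, 7, 11, \<dots>\<close>, where the alternant factors.\<close>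

section \<open>Alternants\<close>

lemma det_mat_sum:
  "det (mat m m f) = (\<Sum>p | p permutes {..<m}. signof p * (\<Prod>i<m. f (i, p i)))"
  (is "_ = ?r")
proof -
  have "det (mat m m f) = (\<Sum>p | p permutes {0..<m}. signof p * (\<Prod>i = 0..<m. mat m m f $$ (i, p i)))"
    by (rule det_def') auto
  also have "\<dots> = (\<Sum>p | p permutes {0..<m}. signof p * (\<Prod>i = 0..<m. f (i, p i)))"
  proof (intro sum.cong refl arg_cong2[where f = "(*)"] prod.cong)
    fix p i assume "p \<in> {p. p permutes {0..<m}}" "i \<in> {0..<m}"
    then have "p i < m" using permutes_in_image[of p "{0..<m}" i] by auto
    then show "mat m m f $$ (i, p i) = f (i, p i)" using \<open>i \<in> {0..<m}\<close> by auto
  qed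
  finally show ?thesis by (simp add: atLeast0LessThan)
qed

lemma det_mat_scale_rows:
  "det (mat m m (\<lambda>(i, j). w i * f i j)) = (\<Prod>i<m. w i) * det (mat m m (\<lambda>(i, j). f i j))"
  by (simp add: det_mat_sum prod.distrib sum_distrib_left mult_ac)

text \<open>Multilinearity in the rows: each term of the Leibniz expansion contains one factor per
  row, so the independent sums over the \<open>t i\<close> can be carried out factor by
  factor.\<close>

lemma sum_PiE_det:
  fixes f :: "'a \<Rightarrow> nat \<Rightarrow> 'b::comm_ring_1"
  assumes "\<And>i. i < m \<Longrightarrow> finite (I i)"
  shows "(\<Sum>t\<in>PiE {..<m} I. det (mat m m (\<lambda>(i, j). f (t i) j))) =
    det (mat m m (\<lambda>(i, j). \<Sum>y\<in>I i. f y j))"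
proof -
  have "(\<Sum>t\<in>PiE {..<m} I. det (mat m m (\<lambda>(i, j). f (t i) j))) =
    (\<Sum>p | p permutes {..<m}. signof p * (\<Sum>t\<in>PiE {..<m} I. \<Prod>i<m. f (t i) (p i)))"
    unfolding det_mat_sum by (subst sum.swap) (simp add: sum_distrib_left)
  also have "\<dots> = (\<Sum>p | p permutes {..<m}. signof p * (\<Prod>i<m. \<Sum>y\<in>I i. f y (p i)))"
    using assms by (subst prod_sum_PiE) auto
  finally show ?thesis by (simp add: det_mat_sum)
qed

text \<open>The left-hand matrix is the matrix of \<open>g\<close> times the upper triangular matrix
  of coefficients. This reduces polynomials of increasing degree to their leading terms.\<close>

lemma det_mat_triangular_comb:
  fixes g :: "nat \<Rightarrow> nat \<Rightarrow> 'a::comm_ring_1"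
  shows "det (mat m m (\<lambda>(i, j). \<Sum>k\<le>j. c j k * g i k)) =
    (\<Prod>j<m. c j j) * det (mat m m (\<lambda>(i, j). g i j))"
proof -
  define U where "U = mat m m (\<lambda>(k, j). if k \<le> j then c j k else 0)"
  have "mat m m (\<lambda>(i, j). \<Sum>k\<le>j. c j k * g i k) = mat m m (\<lambda>(i, j). g i j) * U"
  proof (rule eq_matI, goal_cases)
    case (1 i j)
    then have "(\<Sum>k\<le>j. c j k * g i k) = (\<Sum>k = 0..<m. g i k * (if k \<le> j then c j k else 0))"
      by (intro sum.mono_neutral_cong_left) (auto simp: U_def mult.commute)
    with 1 show ?case by (auto simp: U_def scalar_prod_def)
  qed (auto simp: U_def)
  moreover have "det U = (\<Prod>j<m. c j j)"
  proof -
    have "det U = prod_list (diag_mat U)"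
      by (rule det_upper_triangular[of _ m]) (auto simp: U_def)
    then show ?thesis
      by (simp add: U_def diag_mat_def prod.list_conv_set_nth atLeast0LessThan)
  qed
  ultimately show ?thesis
    by (simp add: det_mult[of _ m] U_def mult.commute)
qed

text \<open>Subtracting from each row its predecessor is multiplication by the unitriangular
  bidiagonal matrix \<open>B\<close>. Column 0 is constant, so only its top entry survives, and
  expansion along it leaves the differences. This is how an interlacing sum gains a row.\<close>

lemma det_mat_row_differences:
  fixes q :: "nat \<Rightarrow> nat \<Rightarrow> 'a::idom"
  assumes q0: "\<And>i. i \<le> m \<Longrightarrow> q i 0 = 1"
  shows "det (mat m m (\<lambda>(i, j). q (Suc i) (Suc j) - q i (Suc j))) =
    det (mat (Suc m) (Suc m) (\<lambda>(i, j). q i j))"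
proof -
  let ?n = "Suc m"
  define B :: "'a mat" where
    "B = mat ?n ?n (\<lambda>(i, k). if k = i then 1 else if Suc k = i then - 1 else 0)"
  define Q where "Q = mat ?n ?n (\<lambda>(i, j). q i j)"
  have detB: "det B = 1"
  proof -
    have "det B = prod_list (diag_mat B)"
      by (rule det_lower_triangular[of ?n]) (auto simp: B_def)
    also have "\<dots> = 1"
      by (simp add: B_def diag_mat_def prod.list_conv_set_nth del: upt_Suc prod.op_ivl_Suc)
    finally show ?thesis .
  qed
  have BQ: "(B * Q) $$ (i, j) = (if i = 0 then q 0 j else q i j - q (i - 1) j)"
    if "i < ?n" "j < ?n" for i j
  proof -
    have "(B * Q) $$ (i, j) =
        (\<Sum>k = 0..<?n. (if k = i then q i j else 0) + (if Suc k = i then - q (i - 1) j else 0))"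
      using that unfolding B_def Q_def
      by (auto simp: scalar_prod_def simp del: sum.op_ivl_Suc intro!: sum.cong)
    also have "\<dots> = q i j + (\<Sum>k = 0..<?n. if Suc k = i then - q (i - 1) j else 0)"
      using that by (subst sum.distrib) (simp del: sum.op_ivl_Suc)
    also have "(\<Sum>k = 0..<?n. if Suc k = i then - q (i - 1) j else 0) =
        (if i = 0 then 0 else - q (i - 1) j)"
    proof (cases i)
      case (Suc i')
      then show ?thesis using that by (simp del: sum.op_ivl_Suc)
    qed simp
    finally show ?thesis by auto
  qed
  have car: "B * Q \<in> carrier_mat ?n ?n"
    by (rule mult_carrier_mat[of _ ?n ?n]) (auto simp: B_def Q_def)
  have "det Q = det (B * Q)"
    using detB by (simp add: det_mult[of _ ?n] B_def Q_def)
  also have "\<dots> = (\<Sum>i<?n. (B * Q) $$ (i, 0) * cofactor (B * Q) i 0)"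
    by (rule laplace_expansion_column[OF car]) simp
  also have "\<dots> = (\<Sum>i<?n. if i = 0 then cofactor (B * Q) 0 0 else 0)"
    by (rule sum.cong) (auto simp: BQ q0)
  also have "\<dots> = cofactor (B * Q) 0 0" by (simp del: sum.lessThan_Suc)
  also have "\<dots> = det (mat_delete (B * Q) 0 0)" by (simp add: cofactor_def)
  also have "mat_delete (B * Q) 0 0 = mat m m (\<lambda>(i, j). q (Suc i) (Suc j) - q i (Suc j))"
    using car by (intro eq_matI) (auto simp: mat_delete_def BQ simp del: index_mult_mat)
  finally show ?thesis by (simp add: Q_def)
qed

text \<open>Up to normalisation these are numerators of the Weyl dimension formula, of type D for
  \<open>e = 0\<close> and of type B or C for \<open>e = 1\<close>.\<close>

definition alternant :: "nat \<Rightarrow> nat \<Rightarrow> (nat \<Rightarrow> int) \<Rightarrow> real" where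
  "alternant m e x = det (mat m m (\<lambda>(i, j). of_int (x i) ^ (2 * j + e)))"

text \<open>Once \<open>x i ^ e\<close> is pulled out of each row, a Vandermonde determinant in the
  squares \<open>y i\<close> remains. The monic polynomials \<open>Q j\<close> vanish at
  \<open>y i\<close> for \<open>i < j\<close>; using them instead of monomials keeps the determinant
  and makes the matrix lower triangular.\<close>

lemma alternant_eq_prod:
  "alternant m e x =
    (\<Prod>i<m. of_int (x i) ^ e) * (\<Prod>j<m. \<Prod>i<j. of_int (x j) ^ 2 - of_int (x i) ^ 2)"
proof -
  define y where "y i = (of_int (x i) ^ 2 :: real)" for i
  define Q where "Q j = (\<Prod>k<j. [:- y k, 1:])" for j
  have deg: "degree (Q j) = j" for j
    unfolding Q_def by (subst degree_prod_eq_sum_degree) auto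
  have lead: "coeff (Q j) j = 1" for j
    using lead_coeff_prod[of "\<lambda>k. [:- y k, 1:]" "{..<j}"] deg[of j] by (simp add: Q_def)
  have "alternant m e x = det (mat m m (\<lambda>(i, j). of_int (x i) ^ e * y i ^ j))"
    unfolding alternant_def y_def by (simp add: power_add mult.commute flip: power_mult)
  also have "\<dots> = (\<Prod>i<m. of_int (x i) ^ e) * det (mat m m (\<lambda>(i, j). y i ^ j))"
    by (rule det_mat_scale_rows)
  also have "det (mat m m (\<lambda>(i, j). y i ^ j)) =
      det (mat m m (\<lambda>(i, j). \<Sum>k\<le>j. coeff (Q j) k * y i ^ k))"
    by (subst det_mat_triangular_comb) (simp add: lead)
  also have "\<dots> = det (mat m m (\<lambda>(i, j). poly (Q j) (y i)))"
    by (simp add: poly_altdef deg)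
  also have "\<dots> = prod_list (diag_mat (mat m m (\<lambda>(i, j). poly (Q j) (y i))))"
    by (rule det_lower_triangular[of m]) (auto simp: Q_def poly_prod)
  also have "\<dots> = (\<Prod>j<m. poly (Q j) (y j))"
    by (simp add: diag_mat_def prod.list_conv_set_nth atLeast0LessThan)
  also have "\<dots> = (\<Prod>j<m. \<Prod>i<j. y j - y i)"
    by (simp add: Q_def poly_prod)
  finally show ?thesis by (simp add: y_def)
qed

text \<open>Together with the vanishing at a zero entry below, this lets sums run over a whole box
  of configurations: inadmissible ones contribute nothing.\<close>

lemma alternant_eq_0_if_not_inj:
  assumes "\<not> inj_on x {..<m}"
  shows "alternant m e x = 0"
proof -
  obtain i j where "i < j" "j < m" "x i = x j"
    using assms unfolding inj_on_def by (metis lessThan_iff linorder_neqE_nat)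
  then have "(\<Prod>j<m. \<Prod>i<j. of_int (x j) ^ 2 - of_int (x i) ^ 2 :: real) = 0"
    by (intro prod_zero bexI[of _ j] bexI[of _ i]) auto
  then show ?thesis by (simp add: alternant_eq_prod)
qed

lemma alternant_eq_0_if_zero:
  "i < m \<Longrightarrow> x i = 0 \<Longrightarrow> e \<noteq> 0 \<Longrightarrow> alternant m e x = 0"
  unfolding alternant_eq_prod by auto

section \<open>Parity classes in binomial expansions\<close>

lemma sum_parity_class:
  fixes g :: "nat \<Rightarrow> 'a::comm_monoid_add"
  assumes "e \<le> 1" "\<And>i. odd (i + e) \<Longrightarrow> g i = 0" "N = 2 * j + e \<or> N = 2 * j + e + 1"
  shows "(\<Sum>i\<le>N. g i) = (\<Sum>k\<le>j. g (2 * k + e))"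
proof -
  have "(\<Sum>k\<le>j. g (2 * k + e)) = sum g ((\<lambda>k. 2 * k + e) ` {..j})"
    by (subst sum.reindex) (auto simp: inj_on_def)
  also have "\<dots> = sum g {..N}"
  proof (rule sum.mono_neutral_left)
    show "\<forall>i\<in>{..N} - (\<lambda>k. 2 * k + e) ` {..j}. g i = 0"
    proof
      fix i assume i: "i \<in> {..N} - (\<lambda>k. 2 * k + e) ` {..j}"
      have "odd (i + e)"
      proof
        assume "even (i + e)"
        with assms(1,3) i have "i = 2 * ((i - e) div 2) + e" "(i - e) div 2 \<le> j"
          by (auto elim!: evenE) presburger+
        with i show False by blast
      qed
      then show "g i = 0" by (rule assms)
    qed
  qed (use assms(3) in auto)
  finally show ?thesis ..
qed

lemma power_add_one_plus_power_minus_one: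
  fixes y :: real
  assumes "e \<le> 1"
  shows "(y - 1) ^ (2 * j + e) + (y + 1) ^ (2 * j + e) =
    (\<Sum>k\<le>j. 2 * real ((2 * j + e) choose (2 * k + e)) * y ^ (2 * k + e))"
proof -
  let ?N = "2 * j + e"
  have "(y - 1) ^ ?N + (y + 1) ^ ?N =
    (\<Sum>i\<le>?N. real (?N choose i) * (1 + (- 1) ^ (?N - i)) * y ^ i)"
    using binomial_ring[of y 1 ?N] binomial_ring[of y "- 1" ?N]
    by (simp add: sum.distrib[symmetric] algebra_simps)
  also have "\<dots> = (\<Sum>k\<le>j. real (?N choose (2 * k + e)) * (1 + (- 1) ^ (?N - (2 * k + e))) * y ^ (2 * k + e))"
  proof (rule sum_parity_class[OF assms])
    fix i assume "odd (i + e)"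
    then show "real (?N choose i) * (1 + (- 1) ^ (?N - i)) * y ^ i = 0"
      by (cases "i \<le> ?N") (auto simp: binomial_eq_0)
  qed simp
  finally show ?thesis by (auto intro!: sum.cong)
qed

text \<open>The powers with the parity of the exponent \<open>2 * j + e + 1\<close> cancel, so
  differencing lowers the degree by one and lands in the other parity class. This is the source of
  the flip of \<open>e\<close>.\<close>

lemma power_add_one_minus_power_minus_one:
  fixes y :: real
  assumes "e \<le> 1"
  shows "(y + 1) ^ (2 * j + e + 1) - (y - 1) ^ (2 * j + e + 1) =
    (\<Sum>k\<le>j. 2 * real ((2 * j + e + 1) choose (2 * k + e)) * y ^ (2 * k + e))"
proof -
  let ?N = "2 * j + e + 1"
  have "(y + 1) ^ ?N - (y - 1) ^ ?N =
    (\<Sum>i\<le>?N. real (?N choose i) * (1 - (- 1) ^ (?N - i)) * y ^ i)"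
    unfolding diff_conv_add_uminus[of y 1] binomial_ring sum_subtractf[symmetric]
    by (simp add: algebra_simps)
  also have "\<dots> = (\<Sum>k\<le>j. real (?N choose (2 * k + e)) * (1 - (- 1) ^ (?N - (2 * k + e))) * y ^ (2 * k + e))"
  proof (rule sum_parity_class[OF assms])
    fix i assume "odd (i + e)"
    then show "real (?N choose i) * (1 - (- 1) ^ (?N - i)) * y ^ i = 0"
      by (cases "i \<le> ?N") (auto simp: binomial_eq_0)
  qed simp
  also have "\<dots> = (\<Sum>k\<le>j. 2 * real (?N choose (2 * k + e)) * y ^ (2 * k + e))"
  proof (intro sum.cong refl)
    fix k assume "k \<in> {..j}"
    then have "odd (?N - (2 * k + e))" by auto
    then show "real (?N choose (2 * k + e)) * (1 - (- 1) ^ (?N - (2 * k + e))) * y ^ (2 * k + e) =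
      2 * real (?N choose (2 * k + e)) * y ^ (2 * k + e)" by simp
  qed
  finally show ?thesis .
qed

lemma det_power_sums:
  assumes "e \<le> 1"
  shows "det (mat m m (\<lambda>(i, j). (real_of_int (t i) - 1) ^ (2 * j + e) + (of_int (t i) + 1) ^ (2 * j + e)))
    = 2 ^ m * alternant m e t"
  unfolding power_add_one_plus_power_minus_one[OF assms] alternant_def
  by (subst det_mat_triangular_comb) simp

text \<open>Column operations remove the lower powers; the constants are the leading coefficients,
  \<open>2\<close> times the binomial coefficient of \<open>2 * j + e + 1\<close> over
  \<open>2 * j + e\<close>.\<close>

lemma det_power_differences:
  assumes "e \<le> 1"
  shows "det (mat m m (\<lambda>(i, j). (of_int (t i) + 1) ^ (2 * j + e + 1) - (real_of_int (t i) - 1) ^ (2 * j + e + 1)))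
    = (\<Prod>j<m. 2 * real (2 * j + e + 1)) * alternant m e t"
  unfolding power_add_one_minus_power_minus_one[OF assms] alternant_def
  by (subst det_mat_triangular_comb) simp

lemma det_mat_first_row_unit:
  fixes q :: "nat \<Rightarrow> nat \<Rightarrow> 'a::comm_ring_1"
  assumes "q 0 0 = 1" "\<And>j. j < m \<Longrightarrow> q 0 (Suc j) = 0"
  shows "det (mat (Suc m) (Suc m) (\<lambda>(i, j). q i j)) = det (mat m m (\<lambda>(i, j). q (Suc i) (Suc j)))"
proof -
  define Q where "Q = mat (Suc m) (Suc m) (\<lambda>(i, j). q i j)"
  have car: "Q \<in> carrier_mat (Suc m) (Suc m)" by (simp add: Q_def)
  have "det Q = (\<Sum>j<Suc m. Q $$ (0, j) * cofactor Q 0 j)"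
    by (rule laplace_expansion_row[OF car]) simp
  also have "\<dots> = (\<Sum>j<Suc m. if j = 0 then cofactor Q 0 0 else 0)"
  proof (intro sum.cong refl)
    fix j assume "j \<in> {..<Suc m}"
    then show "Q $$ (0, j) * cofactor Q 0 j = (if j = 0 then cofactor Q 0 0 else 0)"
      using assms by (cases j) (auto simp: Q_def)
  qed
  also have "\<dots> = det (mat_delete Q 0 0)" by (simp add: cofactor_def del: sum.lessThan_Suc)
  also have "mat_delete Q 0 0 = mat m m (\<lambda>(i, j). q (Suc i) (Suc j))"
    by (rule eq_matI) (auto simp: mat_delete_def Q_def)
  finally show ?thesis by (simp add: Q_def)
qed

text \<open>A particle at position 0 is reached from position 1 only, since \<open>-1\<close> lies behind the wall; for
  even alternants this halves the sum of the contributions of \<open>\<plusminus>1\<close>.\<close>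

definition wall_weight :: "nat \<Rightarrow> int \<Rightarrow> real" where
  "wall_weight e t = (if e = 0 \<and> t = 0 then 1 / 2 else 1)"

text \<open>By multilinearity the two targets are summed entrywise. For \<open>e = 1\<close> the
  target 0 is included at no cost, as odd powers vanish there. For \<open>e = 0\<close> a start at 0
  loses the target -1, which is exactly one of two equal even powers.\<close>

lemma sum_unit_steps_alternant:
  assumes e: "e \<le> 1" and t: "\<And>i. i < m \<Longrightarrow> int e \<le> t i"
  shows "(\<Sum>u\<in>PiE {..<m} (\<lambda>i. {y \<in> {t i - 1, t i + 1}. 0 \<le> y}). alternant m e u) =
    2 ^ m * ((\<Prod>i<m. wall_weight e (t i)) * alternant m e t)"
proof -
  have entry: "(\<Sum>y | y \<in> {t i - 1, t i + 1} \<and> 0 \<le> y. real_of_int y ^ (2 * j + e)) =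
      wall_weight e (t i) * ((of_int (t i) - 1) ^ (2 * j + e) + (of_int (t i) + 1) ^ (2 * j + e))"
    if "i < m" for i j
  proof (cases "t i = 0")
    case True
    with e t[OF that] have "e = 0" by simp
    moreover have "{y \<in> {t i - 1, t i + 1}. 0 \<le> y} = {1}" using True by auto
    ultimately show ?thesis using True by (simp add: wall_weight_def)
  next
    case False
    with t[OF that] have "{y \<in> {t i - 1, t i + 1}. 0 \<le> y} = {t i - 1, t i + 1}" by auto
    with False show ?thesis by (simp add: wall_weight_def)
  qed
  have "(\<Sum>u\<in>PiE {..<m} (\<lambda>i. {y \<in> {t i - 1, t i + 1}. 0 \<le> y}). alternant m e u) =
      det (mat m m (\<lambda>(i, j). \<Sum>y | y \<in> {t i - 1, t i + 1} \<and> 0 \<le> y. real_of_int y ^ (2 * j + e)))"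
    unfolding alternant_def by (subst sum_PiE_det[symmetric]) auto
  also have "\<dots> = det (mat m m (\<lambda>(i, j). wall_weight e (t i) *
      ((of_int (t i) - 1) ^ (2 * j + e) + (of_int (t i) + 1) ^ (2 * j + e))))"
  proof (intro arg_cong[where f = det] eq_matI, goal_cases)
    case (1 i j)
    then show ?case using entry[of i j] by simp
  qed auto
  also have "\<dots> = 2 ^ m * ((\<Prod>i<m. wall_weight e (t i)) * alternant m e t)"
    by (simp add: det_mat_scale_rows det_power_sums[OF e])
  finally show ?thesis .
qed

text \<open>Adjacent levels carry positions of opposite parity; these are the places on the next
  level between consecutive holes \<open>p\<close> and \<open>q\<close>.\<close>

definition gap :: "int \<Rightarrow> int \<Rightarrow> int set" where
  "gap p q = {y. p < y \<and> y < q \<and> odd (y - p)}"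

lemma finite_gap [simp]: "finite (gap p q)"
  by (rule finite_subset[of _ "{p..q}"]) (auto simp: gap_def)

lemma gap_empty [simp]: "gap p p = {}"
  by (auto simp: gap_def)

lemma gap_step:
  assumes "even (q - p)" "p \<le> q"
  shows "gap p (q + 2) = insert (q + 1) (gap p q)"
  using assms by (auto simp: gap_def) presburger+

lemma sum_gap_telescope:
  fixes f :: "int \<Rightarrow> real"
  assumes "even (q - p)" "p \<le> q"
  shows "(\<Sum>y\<in>gap p q. f (y + 1) - f (y - 1)) = f q - f p"
proof -
  define k where "k = nat ((q - p) div 2)"
  have "q = p + 2 * int k"
    using assms by (auto simp: k_def elim!: evenE)
  moreover have "(\<Sum>y\<in>gap p (p + 2 * int k). f (y + 1) - f (y - 1)) = f (p + 2 * int k) - f p"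
  proof (induction k)
    case (Suc k)
    have "p + 2 * int (Suc k) = (p + 2 * int k) + 2" by simp
    moreover have "p + 2 * int k + 1 \<notin> gap p (p + 2 * int k)" by (simp add: gap_def)
    ultimately show ?case
      using gap_step[of "p + 2 * int k" p] Suc by (simp add: add_ac)
  qed simp
  ultimately show ?thesis by simp
qed

text \<open>The boundary term at \<open>p\<close> has to vanish for the odd function
  \<open>f\<close>. For \<open>p = 0\<close> it is \<open>f 0 = 0\<close>. For
  \<open>p = - 1\<close> the gap starts at 0, which with weight 1/2 contributes
  \<open>(f 1 - f (- 1)) / 2 = f 1\<close> and cancels the boundary term of the rest.\<close>

lemma sum_gap_telescope_wall:
  assumes "even (q - p)" "p \<le> q" "p = 0 \<or> p = - 1" "0 \<le> q"
  shows "(\<Sum>y\<in>gap p q. wall_weight 0 y *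
      ((of_int y + 1) ^ (2 * j + 1) - (real_of_int y - 1) ^ (2 * j + 1))) = of_int q ^ (2 * j + 1)"
proof -
  define f where "f y = (of_int y ^ (2 * j + 1) :: real)" for y :: int
  have f: "(of_int y + 1) ^ (2 * j + 1) - (real_of_int y - 1) ^ (2 * j + 1) = f (y + 1) - f (y - 1)" for y
    by (simp add: f_def)
  have "(\<Sum>y\<in>gap p q. wall_weight 0 y * (f (y + 1) - f (y - 1))) = f q"
  proof (cases "p = 0")
    case True
    then have "(\<Sum>y\<in>gap p q. wall_weight 0 y * (f (y + 1) - f (y - 1))) =
        (\<Sum>y\<in>gap p q. f (y + 1) - f (y - 1))"
      by (intro sum.cong) (auto simp: gap_def wall_weight_def)
    then show ?thesis using sum_gap_telescope[OF assms(1,2), of f] True by (simp add: f_def)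
  next
    case False
    with assms have p: "p = - 1" by simp
    have q: "1 \<le> q" "even (q - 1)" using assms p by presburger+
    have gap: "gap p q = insert 0 (gap 1 q)"
      using q p by (auto simp: gap_def)
    have "(\<Sum>y\<in>gap 1 q. wall_weight 0 y * (f (y + 1) - f (y - 1))) =
        (\<Sum>y\<in>gap 1 q. f (y + 1) - f (y - 1))"
      by (intro sum.cong) (auto simp: gap_def wall_weight_def)
    also have "\<dots> = f q - f 1" using q by (intro sum_gap_telescope) auto
    finally have "(\<Sum>y\<in>gap 1 q. wall_weight 0 y * (f (y + 1) - f (y - 1))) = f q - f 1" .
    moreover have "0 \<notin> gap 1 q" by (simp add: gap_def)
    moreover have "wall_weight 0 0 = 1 / 2" "f 1 = 1" "f (- 1) = - 1"
      by (simp_all add: wall_weight_def f_def)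
    ultimately show ?thesis unfolding gap by simp
  qed
  then show ?thesis unfolding f by (simp add: f_def)
qed

text \<open>Up to a constant, the alternant of odd powers is a determinant of differences of the
  even powers \<open>2 * j + 2\<close>. These telescope over each gap to row differences, and the
  power 0 supplies the constant column that turns them into an alternant with one more row.\<close>

lemma sum_interlacing_odd_alternant:
  assumes s: "\<And>i. i < m \<Longrightarrow> s i \<le> s (Suc i) \<and> even (s (Suc i) - s i)"
  shows "(\<Sum>t\<in>PiE {..<m} (\<lambda>i. gap (s i) (s (Suc i))).
      (\<Prod>i<m. wall_weight 1 (t i)) * alternant m 1 t) =
    alternant (Suc m) 0 s / (\<Prod>j<m. 2 * real (2 * j + 2))"
proof -
  define P where "P = (\<Prod>j<m. 2 * real (2 * j + 2))"
  have P: "P \<noteq> 0" by (simp add: P_def)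
  let ?D = "\<lambda>y j. (of_int y + 1) ^ (2 * j + 2) - (real_of_int y - 1) ^ (2 * j + 2)"
  have "P * (\<Sum>t\<in>PiE {..<m} (\<lambda>i. gap (s i) (s (Suc i))). alternant m 1 t) =
      (\<Sum>t\<in>PiE {..<m} (\<lambda>i. gap (s i) (s (Suc i))). det (mat m m (\<lambda>(i, j). ?D (t i) j)))"
    using det_power_differences[of 1 m] by (simp add: P_def sum_distrib_left)
  also have "\<dots> = det (mat m m (\<lambda>(i, j). \<Sum>y\<in>gap (s i) (s (Suc i)). ?D y j))"
    by (rule sum_PiE_det) simp
  also have "\<dots> = det (mat m m (\<lambda>(i, j). of_int (s (Suc i)) ^ (2 * Suc j) - of_int (s i) ^ (2 * Suc j)))"
  proof (intro arg_cong[where f = det] eq_matI, goal_cases)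
    case (1 i j)
    then show ?case
      using s sum_gap_telescope[of "s (Suc i)" "s i" "\<lambda>y. of_int y ^ (2 * j + 2)"] by simp
  qed auto
  also have "\<dots> = det (mat (Suc m) (Suc m) (\<lambda>(i, j). real_of_int (s i) ^ (2 * j)))"
    by (rule det_mat_row_differences) simp
  also have "\<dots> = alternant (Suc m) 0 s"
    by (simp add: alternant_def)
  finally show ?thesis
    unfolding P_def[symmetric] by (simp add: eq_divide_eq P mult.commute wall_weight_def)
qed

text \<open>Differences of odd powers telescope in the same way, but the weight at the wall removes
  the boundary term at \<open>s 0\<close>. This entry drops out, so the number of rows stays
  \<open>m\<close>.\<close>

lemma sum_interlacing_even_alternant:
  assumes s: "\<And>i. i < m \<Longrightarrow> s i \<le> s (Suc i) \<and> even (s (Suc i) - s i)"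
    and s0: "s 0 = 0 \<or> s 0 = - 1" and pos: "\<And>i. 0 < i \<Longrightarrow> i \<le> m \<Longrightarrow> 0 \<le> s i"
  shows "(\<Sum>t\<in>PiE {..<m} (\<lambda>i. gap (s i) (s (Suc i))).
      (\<Prod>i<m. wall_weight 0 (t i)) * alternant m 0 t) =
    alternant m 1 (\<lambda>i. s (Suc i)) / (\<Prod>j<m. 2 * real (2 * j + 1))"
proof -
  define P where "P = (\<Prod>j<m. 2 * real (2 * j + 1))"
  have P: "P \<noteq> 0" by (simp add: P_def)
  \<comment> \<open>Column 0 is an artificial constant column; row 0 stands for \<open>s 0\<close>,
    its odd powers replaced by 0. Border and row 0 disappear together in the end.\<close>
  define q where "q i j = (if j = 0 then 1 else if i = 0 then 0 else real_of_int (s i) ^ (2 * j - 1))" for i j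
  let ?D = "\<lambda>y j. wall_weight 0 y * ((of_int y + 1) ^ (2 * j + 1) - (real_of_int y - 1) ^ (2 * j + 1))"
  have "P * (\<Sum>t\<in>PiE {..<m} (\<lambda>i. gap (s i) (s (Suc i))).
      (\<Prod>i<m. wall_weight 0 (t i)) * alternant m 0 t) =
      (\<Sum>t\<in>PiE {..<m} (\<lambda>i. gap (s i) (s (Suc i))). det (mat m m (\<lambda>(i, j). ?D (t i) j)))"
    unfolding det_mat_scale_rows
    using det_power_differences[of 0 m] by (simp add: P_def sum_distrib_left mult_ac)
  also have "\<dots> = det (mat m m (\<lambda>(i, j). \<Sum>y\<in>gap (s i) (s (Suc i)). ?D y j))"
    by (rule sum_PiE_det) simp
  also have "\<dots> = det (mat m m (\<lambda>(i, j). q (Suc i) (Suc j) - q i (Suc j)))"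
  proof (intro arg_cong[where f = det] eq_matI, goal_cases)
    case (1 i j)
    show ?case
    proof (cases "i = 0")
      case True
      then show ?thesis
        using 1 s[of 0] s0 pos[of 1] sum_gap_telescope_wall[of "s 1" "s 0" j] by (simp add: q_def)
    next
      case False
      \<comment> \<open>For \<open>i > 0\<close> the gap lies to the right of
        \<open>s i \<ge> 0\<close>; it avoids 0 and all its weights are 1.\<close>
      have "(\<Sum>y\<in>gap (s i) (s (Suc i)). ?D y j) = (\<Sum>y\<in>gap (s i) (s (Suc i)).
          of_int (y + 1) ^ (2 * j + 1) - of_int (y - 1) ^ (2 * j + 1))"
        using False 1 pos[of i] by (intro sum.cong) (auto simp: gap_def wall_weight_def)
      then show ?thesis
        using False 1 s[of i] sum_gap_telescope[of "s (Suc i)" "s i" "\<lambda>y. of_int y ^ (2 * j + 1)"]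
        by (simp add: q_def)
    qed
  qed auto
  also have "\<dots> = det (mat (Suc m) (Suc m) (\<lambda>(i, j). q i j))"
    by (rule det_mat_row_differences) (simp add: q_def)
  also have "\<dots> = det (mat m m (\<lambda>(i, j). q (Suc i) (Suc j)))"
    by (rule det_mat_first_row_unit) (auto simp: q_def)
  also have "\<dots> = alternant m 1 (\<lambda>i. s (Suc i))"
    by (simp add: alternant_def q_def)
  finally show ?thesis
    unfolding P_def[symmetric] by (simp add: eq_divide_eq P mult.commute)
qed

section \<open>Peeling off cells along a diagonal\<close>

lemma domino_tiling_remove:
  assumes "domino_tiling X D" "d \<in> D"
  shows "domino_tiling (X - d) (D - {d})"
proof -
  have "d' \<inter> d = {}" if "d' \<in> D" "d' \<noteq> d" for d'
    using assms that by (auto simp: domino_tiling_def disjoint_def)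
  then have "\<Union>(D - {d}) = \<Union>D - d" using assms(2) by blast
  moreover have "disjoint (D - {d})"
    using assms by (auto simp: domino_tiling_def disjoint_def)
  ultimately show ?thesis using assms by (auto simp: domino_tiling_def)
qed

lemma domino_tiling_insert:
  assumes "domino_tiling (X - d) D" "domino d" "d \<subseteq> X"
  shows "domino_tiling X (insert d D)"
proof -
  have D: "disjoint D" "\<Union>D = X - d" "\<forall>d'\<in>D. domino d'"
    using assms(1) by (auto simp: domino_tiling_def)
  then have "x \<inter> d = {}" "d \<inter> x = {}" if "x \<in> D" for x
    using that by blast+
  with D(1) have "disjoint (insert d D)" unfolding disjoint_def by blast
  moreover have "\<Union>(insert d D) = X" using D(2) assms(3) by auto
  ultimately show ?thesis using D(3) assms(2) by (simp add: domino_tiling_def)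
qed

lemma domino_nonempty: "domino d \<Longrightarrow> d \<noteq> {}"
  by (auto simp: domino_def)

lemma card_tilings_containing:
  assumes "domino d" "d \<subseteq> X"
  shows "card {D. domino_tiling X D \<and> d \<in> D} = num_tilings (X - d)"
proof -
  have notin: "d \<notin> D" if "domino_tiling (X - d) D" for D
    using that domino_nonempty[OF assms(1)] unfolding domino_tiling_def by blast
  have "bij_betw (\<lambda>D. D - {d}) {D. domino_tiling X D \<and> d \<in> D} {D. domino_tiling (X - d) D}"
    by (rule bij_betw_byWitness[where f' = "insert d"])
      (use notin in \<open>auto intro: domino_tiling_insert[OF _ assms] dest: domino_tiling_remove\<close>)
  then show ?thesis by (simp add: num_tilings_def bij_betw_same_card)
qed

lemma finite_tilings: "finite X \<Longrightarrow> finite {D. domino_tiling X D}"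
  by (rule finite_subset[of _ "Pow (Pow X)"]) (auto simp: domino_tiling_def)

lemma num_tilings_empty: "num_tilings {} = 1"
proof -
  have "{D. domino_tiling {} D} = {{}}"
    using domino_nonempty by (auto simp: domino_tiling_def)
  then show ?thesis by (simp add: num_tilings_def)
qed

text \<open>Without a left or lower neighbour the cell must be paired to the right or upwards, and a
  tiling cannot do both.\<close>

lemma num_tilings_corner:
  assumes "finite X" "(a, b) \<in> X" "(a - 1, b) \<notin> X" "(a, b - 1) \<notin> X"
  shows "num_tilings X =
    (if (a + 1, b) \<in> X then num_tilings (X - {(a, b), (a + 1, b)}) else 0) +
    (if (a, b + 1) \<in> X then num_tilings (X - {(a, b), (a, b + 1)}) else 0)"
proof -
  define S where "S d = {D. domino_tiling X D \<and> d \<in> D}" for d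
  have card_S: "card (S {(a, b), w}) = (if w \<in> X then num_tilings (X - {(a, b), w}) else 0)"
    if "w = (a + 1, b) \<or> w = (a, b + 1)" for w
  proof (cases "w \<in> X")
    case True
    have "domino {(a, b), w}" using that by (auto simp: domino_def)
    then show ?thesis using True assms card_tilings_containing[of "{(a, b), w}" X] by (simp add: S_def)
  next
    case False
    then have "S {(a, b), w} = {}" by (auto simp: S_def domino_tiling_def)
    then show ?thesis using False by simp
  qed
  have "{D. domino_tiling X D} = S {(a, b), (a + 1, b)} \<union> S {(a, b), (a, b + 1)}"
  proof (intro equalityI subsetI)
    fix D assume "D \<in> {D. domino_tiling X D}"
    then have D: "domino_tiling X D" by simp
    then obtain d where d: "d \<in> D" "(a, b) \<in> d" "d \<subseteq> X" "domino d"
      using assms(2) unfolding domino_tiling_def by blast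
    then obtain p q where "d = {(p, q), (p + 1, q)} \<or> d = {(p, q), (p, q + 1)}"
      by (auto simp: domino_def)
    then have "d = {(a, b), (a + 1, b)} \<or> d = {(a, b), (a, b + 1)}"
    proof
      assume "d = {(p, q), (p + 1, q)}"
      with d assms(3) show ?thesis by (cases "p = a") auto
    next
      assume "d = {(p, q), (p, q + 1)}"
      with d assms(4) show ?thesis by (cases "q = b") auto
    qed
    with D d(1) show "D \<in> S {(a, b), (a + 1, b)} \<union> S {(a, b), (a, b + 1)}"
      by (auto simp: S_def)
  qed (auto simp: S_def)
  moreover have "S {(a, b), (a + 1, b)} \<inter> S {(a, b), (a, b + 1)} = {}"
  proof -
    have "{(a, b), (a + 1, b)} \<noteq> {(a, b), (a, b + 1)}" by (auto simp: doubleton_eq_iff)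
    then have False if "disjoint D" "{(a, b), (a + 1, b)} \<in> D" "{(a, b), (a, b + 1)} \<in> D" for D
      using disjointD[OF that] by auto
    then show ?thesis by (auto simp: S_def domino_tiling_def)
  qed
  moreover have "finite (S d)" for d
    using finite_tilings[OF assms(1)] by (rule rev_finite_subset) (auto simp: S_def)
  ultimately have "num_tilings X = card (S {(a, b), (a + 1, b)}) + card (S {(a, b), (a, b + 1)})"
    by (simp add: num_tilings_def card_Un_disjoint)
  then show ?thesis by (simp add: card_S)
qed

text \<open>The cells on the diagonal \<open>a + b = c\<close> with position \<open>b - a\<close> in \<open>A\<close>; positions of the wrong
  parity contribute nothing.\<close>

definition lev :: "int \<Rightarrow> int set \<Rightarrow> region" where
  "lev c A = {(a, b). a + b = c \<and> b - a \<in> A}"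

lemma finite_lev [simp]: "finite A \<Longrightarrow> finite (lev c A)"
  by (rule finite_subset[of _ "(\<lambda>x. ((c - x) div 2, (c + x) div 2)) ` A"])
    (force simp: lev_def image_iff)+

lemma lev_empty [simp]: "lev c {} = {}"
  by (simp add: lev_def)

lemma lev_Un: "lev c (A \<union> B) = lev c A \<union> lev c B"
  by (auto simp: lev_def)

lemma lev_insert: "lev c (insert x A) = lev c {x} \<union> lev c A"
  by (auto simp: lev_def)

lemma lev_Int: "lev c (A \<inter> B) = lev c A \<inter> lev c B"
  by (auto simp: lev_def)

lemma lev_Diff: "lev c (A - B) = lev c A - lev c B"
  by (auto simp: lev_def)

lemma lev_single:
  assumes "even (c + x)"
  shows "lev c {x} = {((c - x) div 2, (c + x) div 2)}"
proof -
  have "(c - x) div 2 + (c + x) div 2 = c" "(c + x) div 2 - (c - x) div 2 = x"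
    using assms by presburger+
  then show ?thesis unfolding lev_def by auto
qed

lemma lev_cong: "(\<And>x. even (c + x) \<Longrightarrow> x \<in> A \<longleftrightarrow> x \<in> B) \<Longrightarrow> lev c A = lev c B"
proof -
  assume *: "\<And>x. even (c + x) \<Longrightarrow> x \<in> A \<longleftrightarrow> x \<in> B"
  have "b - a \<in> A \<longleftrightarrow> b - a \<in> B" if "a + b = c" for a b :: int
    by (rule *) (simp flip: that)
  then show ?thesis by (auto simp: lev_def)
qed

text \<open>This makes every cell of level \<open>c\<close> a corner: its left and lower neighbours
  would lie on level \<open>c - 1\<close>, where no cell is left.\<close>

definition above :: "int \<Rightarrow> region \<Rightarrow> bool" where
  "above c Y \<longleftrightarrow> finite Y \<and> (\<forall>(a, b)\<in>Y. c < a + b)"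

lemma above_Diff: "above c Y \<Longrightarrow> above c (Y - Z)"
  by (auto simp: above_def)

text \<open>The right and upper neighbours of the cell at \<open>x\<close> have positions
  \<open>x - 1\<close> and \<open>x + 1\<close> on level \<open>c + 1\<close>. By parity each
  \<open>lev (c + 1) {y}\<close> here is a single cell, so the inclusion in \<open>Y\<close> tests
  its presence.\<close>

lemma num_tilings_peel:
  assumes Y: "above c Y" and A: "finite A" "x \<notin> A" "even (c + x)"
  shows "num_tilings (Y \<union> lev c (insert x A)) =
    (\<Sum>y\<in>{x - 1, x + 1}. if lev (c + 1) {y} \<subseteq> Y then num_tilings (Y - lev (c + 1) {y} \<union> lev c A) else 0)"
proof -
  define a b where "a = (c - x) div 2" and "b = (c + x) div 2"
  have ab: "a + b = c" "b - a = x" using A(3) unfolding a_def b_def by presburger+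
  have l: "lev (c + 1) {x - 1} = {(a + 1, b)}" "lev (c + 1) {x + 1} = {(a, b + 1)}"
    using ab by (auto simp: lev_def)
  let ?X = "Y \<union> lev c (insert x A)"
  have 1: "(a + 1, b) \<in> ?X \<longleftrightarrow> lev (c + 1) {x - 1} \<subseteq> Y" "(a, b + 1) \<in> ?X \<longleftrightarrow> lev (c + 1) {x + 1} \<subseteq> Y"
    using ab unfolding l by (auto simp: lev_def)
  have 2: "?X - {(a, b), (a + 1, b)} = Y - lev (c + 1) {x - 1} \<union> lev c A"
    "?X - {(a, b), (a, b + 1)} = Y - lev (c + 1) {x + 1} \<union> lev c A"
    unfolding l using ab A(2) Y by (auto simp: lev_def above_def)
  have "num_tilings ?X = (if (a + 1, b) \<in> ?X then num_tilings (?X - {(a, b), (a + 1, b)}) else 0) +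
    (if (a, b + 1) \<in> ?X then num_tilings (?X - {(a, b), (a, b + 1)}) else 0)"
  proof (rule num_tilings_corner)
    show "finite ?X" using Y A(1) by (simp add: above_def)
  qed (use Y ab in \<open>auto simp: above_def lev_def\<close>)
  then show ?thesis unfolding 1 2 by simp
qed

lemma sum_PiE_insert:
  assumes "k \<notin> A"
  shows "(\<Sum>f\<in>PiE (insert k A) B. h f) = (\<Sum>y\<in>B k. \<Sum>g\<in>PiE A B. h (g(k := y)))"
  unfolding PiE_insert_eq sum.cartesian_product
  by (subst sum.reindex[OF inj_combinator[OF assms]]) (simp add: case_prod_unfold comp_def)

text \<open>Cells of one level are not adjacent to each other, so they are peeled one by one, each
  taking one of its two neighbours above. Choices that collide or leave the region count
  zero.\<close>

lemma num_tilings_unit_steps: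
  fixes m :: nat
  assumes "above c Y" "inj_on t {..<m}" "\<And>i. i < m \<Longrightarrow> even (c + t i)"
  shows "num_tilings (Y \<union> lev c (t ` {..<m})) =
    (\<Sum>u\<in>PiE {..<m} (\<lambda>i. {t i - 1, t i + 1}).
      if inj_on u {..<m} \<and> lev (c + 1) (u ` {..<m}) \<subseteq> Y
      then num_tilings (Y - lev (c + 1) (u ` {..<m})) else 0)"
  using assms
proof (induction m arbitrary: Y)
  case 0
  then show ?case by simp
next
  case (Suc m)
  let ?B = "\<lambda>i. {t i - 1, t i + 1}"
  let ?F = "\<lambda>Y k u. if inj_on u {..<k} \<and> lev (c + 1) (u ` {..<k}) \<subseteq> Y
      then num_tilings (Y - lev (c + 1) (u ` {..<k})) else 0"
  have tm: "t m \<notin> t ` {..<m}" "inj_on t {..<m}"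
    using Suc.prems(2) by (force simp: inj_on_def)+
  \<comment> \<open>The target \<open>y\<close> of the last cell is removed first. As its level set
    is nonempty, avoiding \<open>y\<close> and lying in \<open>Y\<close> merge into one inclusion
    for the remaining targets.\<close>
  have combine: "?F Y (Suc m) (u(m := y)) =
      (if lev (c + 1) {y} \<subseteq> Y then ?F (Y - lev (c + 1) {y}) m u else 0)"
    if "y \<in> ?B m" for u y
  proof -
    have "even (c + 1 + y)" using that Suc.prems(3)[of m] by auto
    then have ne: "lev (c + 1) {y} \<noteq> {}" by (simp add: lev_single)
    have im: "(u(m := y)) ` {..<Suc m} = insert y (u ` {..<m})"
      by (auto simp: lessThan_Suc)
    have inj: "inj_on (u(m := y)) {..<Suc m} \<longleftrightarrow> inj_on u {..<m} \<and> y \<notin> u ` {..<m}"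
      by (auto simp: lessThan_Suc inj_on_def)
    have "lev (c + 1) {y} \<inter> lev (c + 1) (u ` {..<m}) = lev (c + 1) ({y} \<inter> u ` {..<m})"
      by (simp add: lev_Int)
    then have "y \<notin> u ` {..<m} \<longleftrightarrow> lev (c + 1) {y} \<inter> lev (c + 1) (u ` {..<m}) = {}"
      using ne by (cases "y \<in> u ` {..<m}") auto
    moreover have "(P \<and> Q) \<and> L \<union> M \<subseteq> Y \<longleftrightarrow> L \<subseteq> Y \<and> P \<and> M \<subseteq> Y - L"
      if "Q \<longleftrightarrow> L \<inter> M = {}" for P Q and L M :: region
      unfolding that by blast
    ultimately have iff: "(inj_on u {..<m} \<and> y \<notin> u ` {..<m}) \<and> lev (c + 1) {y} \<union> lev (c + 1) (u ` {..<m}) \<subseteq> Y \<longleftrightarrow>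
        lev (c + 1) {y} \<subseteq> Y \<and> inj_on u {..<m} \<and> lev (c + 1) (u ` {..<m}) \<subseteq> Y - lev (c + 1) {y}"
      by metis
    have Diff_Un2: "Y - (L \<union> M) = Y - L - M" for L M :: region by blast
    show ?thesis
      unfolding im inj lev_insert[of "c + 1" y "u ` {..<m}"] iff Diff_Un2
      by (cases "lev (c + 1) {y} \<subseteq> Y") (simp_all only: simp_thms if_True if_False)
  qed
  have IH: "num_tilings (Y - lev (c + 1) {y} \<union> lev c (t ` {..<m})) =
      (\<Sum>u\<in>PiE {..<m} ?B. ?F (Y - lev (c + 1) {y}) m u)" for y
    by (rule Suc.IH[OF above_Diff[OF Suc.prems(1)] tm(2)]) (rule Suc.prems(3), simp)
  have "num_tilings (Y \<union> lev c (t ` {..<Suc m})) =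
      (\<Sum>y\<in>?B m. if lev (c + 1) {y} \<subseteq> Y
        then num_tilings (Y - lev (c + 1) {y} \<union> lev c (t ` {..<m})) else 0)"
    unfolding lessThan_Suc image_insert
    by (rule num_tilings_peel[OF Suc.prems(1)]) (simp_all only: tm not_False_eq_True Suc.prems(3) lessI finite_imageI finite_lessThan)
  also have "\<dots> = (\<Sum>y\<in>?B m. if lev (c + 1) {y} \<subseteq> Y
        then (\<Sum>u\<in>PiE {..<m} ?B. ?F (Y - lev (c + 1) {y}) m u) else 0)"
    by (simp only: IH)
  also have "\<dots> = (\<Sum>y\<in>?B m. \<Sum>u\<in>PiE {..<m} ?B. ?F Y (Suc m) (u(m := y)))"
  proof (intro sum.cong refl)
    fix y assume y: "y \<in> ?B m"
    show "(if lev (c + 1) {y} \<subseteq> Y then (\<Sum>u\<in>PiE {..<m} ?B. ?F (Y - lev (c + 1) {y}) m u) else 0) =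
        (\<Sum>u\<in>PiE {..<m} ?B. ?F Y (Suc m) (u(m := y)))"
      unfolding combine[OF y]
      by (cases "lev (c + 1) {y} \<subseteq> Y") (simp_all only: if_True if_False sum.neutral_const)
  qed
  also have "\<dots> = (\<Sum>u\<in>PiE {..<Suc m} ?B. ?F Y (Suc m) u)"
    unfolding lessThan_Suc by (rule sum_PiE_insert[symmetric]) simp
  finally show ?case .
qed

lemma image_fun_upd_lessThan_Suc: "(t(m := y)) ` {..<Suc m} = insert y (t ` {..<m})"
  by (auto simp: lessThan_Suc)

text \<open>The cell at \<open>lo\<close> has no neighbour at \<open>lo - 1\<close> and must take
  \<open>lo + 1\<close>. This deprives the next cell of its neighbour at the smaller position, and
  so on up to \<open>hi\<close>.\<close>

lemma num_tilings_forced_up: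
  assumes "above c Y" "even (c + lo)" "lo \<le> hi" "even (hi - lo)"
    "lev (c + 1) {lo<..<hi} \<subseteq> Y" "lo = hi \<or> lev (c + 1) {lo - 1} \<inter> Y = {}"
  shows "num_tilings (Y \<union> lev c {lo..<hi}) = num_tilings (Y - lev (c + 1) {lo<..<hi})"
proof -
  \<comment> \<open>Induction on the number \<open>k\<close> of cells with the upper end fixed; the
    first forced cell is at \<open>hi - 2 * int k\<close>.\<close>
  have main: "num_tilings (Y \<union> lev c {hi - 2 * int k..<hi}) = num_tilings (Y - lev (c + 1) {hi - 2 * int k<..<hi})"
    if "above c Y" "even (c + hi)" "lev (c + 1) {hi - 2 * int k<..<hi} \<subseteq> Y"
      "k = 0 \<or> lev (c + 1) {hi - 2 * int k - 1} \<inter> Y = {}" for k Y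
    using that
  proof (induction k arbitrary: Y)
    case (Suc k)
    define x where "x = hi - 2 * int (Suc k)"
    have x: "even (c + x)" "hi - 2 * int k = x + 2" "x < hi" using Suc.prems(2) by (auto simp: x_def)
    have ne: "lev (c + 1) {x - 1} \<noteq> {}" using x by (simp add: lev_single)
    have above: "above c (Y - lev (c + 1) {x + 1})" by (rule above_Diff) fact
    have "lev c {x..<hi} = lev c (insert x {x + 2..<hi})"
    proof (rule lev_cong)
      fix y assume "even (c + y)"
      with x have "y \<noteq> x + 1" by auto
      then show "y \<in> {x..<hi} \<longleftrightarrow> y \<in> insert x {x + 2..<hi}" using x by auto
    qed
    moreover have "\<not> lev (c + 1) {x - 1} \<subseteq> Y"
      using Suc.prems(4) ne by (auto simp: x_def)
    moreover have up: "lev (c + 1) {x<..<hi} = lev (c + 1) {x + 1} \<union> lev (c + 1) {x + 2<..<hi}"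
    proof -
      have "lev (c + 1) {x<..<hi} = lev (c + 1) (insert (x + 1) {x + 2<..<hi})"
      proof (rule lev_cong)
        fix y assume "even (c + 1 + y)"
        with x have "y \<noteq> x + 2" by auto
        moreover have "x + 1 < hi" by (simp add: x_def)
        ultimately show "y \<in> {x<..<hi} \<longleftrightarrow> y \<in> insert (x + 1) {x + 2<..<hi}" by auto
      qed
      then show ?thesis by (simp add: lev_insert[of _ _ "{x + 2<..<hi}"])
    qed
    moreover have "lev (c + 1) {x + 1} \<subseteq> Y"
      using Suc.prems(3) up unfolding x_def by blast
    ultimately have "num_tilings (Y \<union> lev c {x..<hi}) =
        num_tilings (Y - lev (c + 1) {x + 1} \<union> lev c {x + 2..<hi})"
      using num_tilings_peel[OF Suc.prems(1), of "{x + 2..<hi}" x] x by simp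
    also have "\<dots> = num_tilings (Y - lev (c + 1) {x + 1} - lev (c + 1) {x + 2<..<hi})"
    proof -
      have "lev (c + 1) {x + 2<..<hi} \<inter> lev (c + 1) {x + 1} = {}"
        by (auto simp: lev_def)
      moreover have "lev (c + 1) {x + 2<..<hi} \<subseteq> Y"
        using Suc.prems(3) up unfolding x_def by blast
      ultimately have "lev (c + 1) {x + 2<..<hi} \<subseteq> Y - lev (c + 1) {x + 1}" by blast
      moreover have "lev (c + 1) {x + 2 - 1} \<inter> (Y - lev (c + 1) {x + 1}) = {}"
        by (auto simp: lev_def)
      ultimately show ?thesis
        using Suc.IH[OF above Suc.prems(2)] unfolding x(2) by blast
    qed
    also have "Y - lev (c + 1) {x + 1} - lev (c + 1) {x + 2<..<hi} = Y - lev (c + 1) {x<..<hi}"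
      unfolding up by blast
    finally show ?case unfolding x_def .
  qed simp
  define k where "k = nat ((hi - lo) div 2)"
  have lo: "hi - 2 * int k = lo" and k: "even (c + hi)" "k = 0 \<longleftrightarrow> lo = hi"
    using assms(2-4) unfolding k_def by (auto, presburger+)
  show ?thesis by (rule main[of Y k, unfolded lo]) (use assms k in auto)
qed

text \<open>The cells of level \<open>c\<close> form, together with those of level \<open>c + 1\<close>, a path, which the missing
  positions \<open>s i\<close> cut into pieces. The piece between \<open>s i\<close> and \<open>s (Suc i)\<close> has one cell more on
  level \<open>c + 1\<close> than on level \<open>c\<close>, and any one of the former may be left over.\<close>

lemma num_tilings_interlacing:
  assumes "above c Y" "even (c + lo)" "lo \<le> s 0" "s m \<le> hi" "even (hi - lo)"
    "\<And>i. i < m \<Longrightarrow> s i < s (Suc i)" "\<And>i. i \<le> m \<Longrightarrow> even (s i - lo)"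
    "lev (c + 1) {lo<..<hi} \<subseteq> Y"
    "lo = s 0 \<or> lev (c + 1) {lo - 1} \<inter> Y = {}" "hi = s m \<or> lev (c + 1) {hi + 1} \<inter> Y = {}"
  shows "num_tilings (Y \<union> lev c ({lo..hi} - s ` {..m})) =
    (\<Sum>t\<in>PiE {..<m} (\<lambda>i. gap (s i) (s (Suc i))).
      num_tilings (Y - lev (c + 1) {lo<..<hi} \<union> lev (c + 1) (t ` {..<m})))"
  using assms(1,3-)
proof (induction "nat (hi - lo)" arbitrary: hi m s Y rule: less_induct)
  case less
  note Y = \<open>above c Y\<close> and inc = less.prems(5) and par = less.prems(6)
  have c_lo: "even (c + lo)" by fact
  have mono: "s i \<le> s j" if "i \<le> j" "j \<le> m" for i j
    using that
  proof (induction j)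
    case (Suc j)
    then show ?case using inc[of j] by (cases "i = Suc j") auto
  qed simp
  have c_hi: "even (c + hi)" using c_lo less.prems(4) by presburger
  have step2: "p \<le> q - 2" if "p < q" "even (c + p)" "even (c + q)" for p q :: int
    using that by presburger
  have c_s: "even (c + s i)" if "i \<le> m" for i using c_lo par[OF that] by auto
  have lo_le: "lo \<le> s i" if "i \<le> m" for i using mono[of 0 i] that less.prems(2) by simp
  have cut: "lev (c + 1) {lo<..<h} = lev (c + 1) {lo<..<h - 2} \<union> lev (c + 1) {h - 1}"
    if "lo < h" "even (c + h)" for h
  proof -
    have "lev (c + 1) {lo<..<h} = lev (c + 1) ({lo<..<h - 2} \<union> {h - 1})"
    proof (rule lev_cong)
      fix y assume "even (c + 1 + y)"
      with that have "y \<noteq> h - 2" by presburger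
      moreover have "lo < h - 1" using that c_lo by presburger
      ultimately show "y \<in> {lo<..<h} \<longleftrightarrow> y \<in> {lo<..<h - 2} \<union> {h - 1}" by auto
    qed
    then show ?thesis unfolding lev_Un .
  qed
  have disj: "lev (c + 1) {lo<..<h - 2} \<inter> lev (c + 1) {h - 1} = {}" for h
    by (auto simp: lev_def)
  consider (right) "s m < hi" | (left) "hi = s m" "m = 0"
    | (adjacent) m' where "hi = s m" "m = Suc m'" "s m' = hi - 2"
    | (gap) m' where "hi = s m" "m = Suc m'" "s m' < hi - 2"
  proof -
    have "s m' < hi - 2 \<or> s m' = hi - 2" if "hi = s m" "m = Suc m'" for m'
    proof -
      have "s m' < hi" using inc[of m'] that by simp
      then have "s m' \<le> hi - 2" using c_s[of m'] c_hi that by (intro step2) auto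
      then show ?thesis by auto
    qed
    then show ?thesis
      using that less.prems(3) by (cases m) (auto simp: le_less)
  qed
  then show ?case
  proof cases
    \<comment> \<open>The cell at \<open>hi\<close> has no neighbour at \<open>hi + 1\<close>, so it
      is forced to take \<open>hi - 1\<close>.\<close>
    case right
    have hi: "lo \<le> hi - 2" "s m \<le> hi - 2"
      using right lo_le[of m] c_hi c_s[of m] c_lo step2[of "s m" hi] by auto
    have "lo < hi" using hi by simp
    note cut' = cut[OF this c_hi]
    have s_lt: "s i < hi" if "i \<le> m" for i using mono[of i m] that right by simp
    have "lev c ({lo..hi} - s ` {..m}) = lev c (insert hi ({lo..hi - 2} - s ` {..m}))"
    proof (rule lev_cong)
      fix y assume "even (c + y)"
      with c_hi have "y \<noteq> hi - 1" by presburger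
      then show "y \<in> {lo..hi} - s ` {..m} \<longleftrightarrow> y \<in> insert hi ({lo..hi - 2} - s ` {..m})"
        using s_lt hi by fastforce
    qed
    moreover have "\<not> lev (c + 1) {hi + 1} \<subseteq> Y"
    proof -
      have "lev (c + 1) {hi + 1} \<noteq> {}" using c_hi by (simp add: lev_single)
      then show ?thesis using less.prems(9) right by blast
    qed
    moreover have "lev (c + 1) {hi - 1} \<subseteq> Y"
      using cut' less.prems(7) by blast
    ultimately have "num_tilings (Y \<union> lev c ({lo..hi} - s ` {..m})) =
        num_tilings (Y - lev (c + 1) {hi - 1} \<union> lev c ({lo..hi - 2} - s ` {..m}))"
      using num_tilings_peel[OF Y, of "{lo..hi - 2} - s ` {..m}" hi] c_hi by simp
    also have "\<dots> = (\<Sum>t\<in>PiE {..<m} (\<lambda>i. gap (s i) (s (Suc i))).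
        num_tilings (Y - lev (c + 1) {hi - 1} - lev (c + 1) {lo<..<hi - 2} \<union> lev (c + 1) (t ` {..<m})))"
    proof (rule less.hyps)
      show "lev (c + 1) {lo<..<hi - 2} \<subseteq> Y - lev (c + 1) {hi - 1}"
        using cut' disj[of hi] less.prems(7) by blast
      show "nat (hi - 2 - lo) < nat (hi - lo)" using hi by simp
      show "above c (Y - lev (c + 1) {hi - 1})" using Y by (simp add: above_Diff)
      show "even (hi - 2 - lo)" using less.prems(4) by simp
      show "s m \<le> hi - 2" using hi by simp
      show "lo = s 0 \<or> lev (c + 1) {lo - 1} \<inter> (Y - lev (c + 1) {hi - 1}) = {}" using less.prems(8) by auto
      show "hi - 2 = s m \<or> lev (c + 1) {hi - 2 + 1} \<inter> (Y - lev (c + 1) {hi - 1}) = {}" by simp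
    qed (use less.prems(2) inc par in simp_all)
    also have "Y - lev (c + 1) {hi - 1} - lev (c + 1) {lo<..<hi - 2} = Y - lev (c + 1) {lo<..<hi}"
      using cut' by blast
    finally show ?thesis .
  next
    case left
    have "{lo..hi} - s ` {..m} = {lo..<hi}" using left by auto
    then show ?thesis
      using num_tilings_forced_up[OF Y c_lo, of hi] less.prems left by simp
  next
    case (adjacent m')
    have m': "s m' \<le> hi - 2" "lo \<le> hi - 2" "lo < hi" and hi: "hi = s (Suc m')"
      using adjacent lo_le[of m'] by auto
    note cut' = cut[OF m'(3) c_hi]
    have "lev c ({lo..hi} - s ` {..m}) = lev c ({lo..hi - 2} - s ` {..m'})"
    proof (rule lev_cong)
      fix y assume "even (c + y)"
      with c_hi have "y \<noteq> hi - 1" by presburger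
      moreover have "s ` {..m} = insert hi (s ` {..m'})"
        using adjacent by (auto simp: atMost_Suc)
      ultimately show "y \<in> {lo..hi} - s ` {..m} \<longleftrightarrow> y \<in> {lo..hi - 2} - s ` {..m'}" by auto
    qed
    then have "num_tilings (Y \<union> lev c ({lo..hi} - s ` {..m})) =
        num_tilings (Y \<union> lev c ({lo..hi - 2} - s ` {..m'}))" by simp
    also have "\<dots> = (\<Sum>t\<in>PiE {..<m'} (\<lambda>i. gap (s i) (s (Suc i))).
        num_tilings (Y - lev (c + 1) {lo<..<hi - 2} \<union> lev (c + 1) (t ` {..<m'})))"
    proof (rule less.hyps)
      show "lev (c + 1) {lo<..<hi - 2} \<subseteq> Y" using cut' less.prems(7) by blast
      show "hi - 2 = s m' \<or> lev (c + 1) {hi - 2 + 1} \<inter> Y = {}" using adjacent by simp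
      show "nat (hi - 2 - lo) < nat (hi - lo)" using m' by simp
      show "above c (Y)" using Y by (simp add: above_Diff)
      show "even (hi - 2 - lo)" using less.prems(4) by simp
      show "s m' \<le> hi - 2" using m' by simp
      show "lo = s 0 \<or> lev (c + 1) {lo - 1} \<inter> (Y) = {}" using less.prems(8) by auto
    qed (use less.prems(2) inc par adjacent(2) in simp_all)
    also have "\<dots> = (\<Sum>y\<in>gap (s m') (s (Suc m')). \<Sum>t\<in>PiE {..<m'} (\<lambda>i. gap (s i) (s (Suc i))).
        num_tilings (Y - lev (c + 1) {lo<..<hi} \<union> lev (c + 1) ((t(m' := y)) ` {..<Suc m'})))"
    proof -
      have "gap (s m') (s (Suc m')) = {hi - 1}"
        using gap_step[of "hi - 2" "hi - 2"] adjacent by simp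
      moreover have "Y - lev (c + 1) {lo<..<hi} \<union> lev (c + 1) ((t(m' := hi - 1)) ` {..<Suc m'}) =
          Y - lev (c + 1) {lo<..<hi - 2} \<union> lev (c + 1) (t ` {..<m'})" for t
      proof -
        have "lev (c + 1) ((t(m' := hi - 1)) ` {..<Suc m'}) =
            lev (c + 1) {hi - 1} \<union> lev (c + 1) (t ` {..<m'})"
          unfolding image_fun_upd_lessThan_Suc by (rule lev_insert)
        then show ?thesis using cut' disj[of hi] less.prems(7) by blast
      qed
      ultimately show ?thesis by simp
    qed
    also have "\<dots> = (\<Sum>t\<in>PiE {..<m} (\<lambda>i. gap (s i) (s (Suc i))).
        num_tilings (Y - lev (c + 1) {lo<..<hi} \<union> lev (c + 1) (t ` {..<m})))"
      unfolding adjacent(2) lessThan_Suc by (rule sum_PiE_insert[symmetric]) simp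
    finally show ?thesis .
  next
    \<comment> \<open>The cell at \<open>hi - 2\<close> takes \<open>hi - 3\<close> or
      \<open>hi - 1\<close>. In the first case \<open>hi - 1\<close> is left over; the second is the
      situation with the last hole moved to \<open>hi - 2\<close>. This splits the last gap into its
      top element and the rest.\<close>
    case (gap m')
    have c_hi2: "even (c + (hi - 2))" using c_hi by simp
    have m': "s m' \<le> hi - 4" "lo \<le> hi - 4" "lo < hi" "lo < hi - 2" 
    proof -
      show "s m' \<le> hi - 4" using gap(2,3) c_s[of m'] c_hi2 step2[of "s m'" "hi - 2"] by simp
      then show "lo \<le> hi - 4" "lo < hi" "lo < hi - 2" using lo_le[of m'] gap(2) by auto
    qed
    note cut1 = cut[OF m'(3) c_hi] and cut2 = cut[OF m'(4) c_hi2]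
    let ?A = "{lo..hi - 4} - s ` {..m'}" and ?s = "s(m := hi - 2)"
    let ?P = "PiE {..<m'} (\<lambda>i. gap (s i) (s (Suc i)))"
    let ?h = "\<lambda>t k. num_tilings (Y - lev (c + 1) {lo<..<hi} \<union> lev (c + 1) (t ` {..<k}))"
    have s_lt: "s i \<le> hi - 4" if "i \<le> m'" for i using mono[of i m'] gap m' that by simp
    have im: "s ` {..m} = insert hi (s ` {..m'})"
      using gap by (auto simp: atMost_Suc)
    have im2: "?s ` {..m} = insert (hi - 2) (s ` {..m'})"
      using gap(2) by (auto simp: atMost_Suc)
    have subs: "lev (c + 1) {hi - 1} \<subseteq> Y" "lev (c + 1) {hi - 3} \<subseteq> Y"
      "lev (c + 1) {lo<..<hi - 2} \<subseteq> Y" "lev (c + 1) {lo<..<hi - 4} \<subseteq> Y"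
      using cut1 cut2 less.prems(7) by auto
    have "lev c ({lo..hi} - s ` {..m}) = lev c (insert (hi - 2) ?A)"
    proof (rule lev_cong)
      fix y assume "even (c + y)"
      with c_hi have "y \<noteq> hi - 1" "y \<noteq> hi - 3" by presburger+
      then show "y \<in> {lo..hi} - s ` {..m} \<longleftrightarrow> y \<in> insert (hi - 2) ?A"
        unfolding im using s_lt m' by fastforce
    qed
    then have "num_tilings (Y \<union> lev c ({lo..hi} - s ` {..m})) =
        num_tilings (Y - lev (c + 1) {hi - 3} \<union> lev c ?A) +
        num_tilings (Y - lev (c + 1) {hi - 1} \<union> lev c ?A)"
      using num_tilings_peel[OF Y, of ?A "hi - 2"] c_hi2 subs by simp
    also have "num_tilings (Y - lev (c + 1) {hi - 3} \<union> lev c ?A) = (\<Sum>t\<in>?P. ?h (t(m' := hi - 1)) m)"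
    proof -
      have "num_tilings (Y - lev (c + 1) {hi - 3} \<union> lev c ?A) = (\<Sum>t\<in>?P.
          num_tilings (Y - lev (c + 1) {hi - 3} - lev (c + 1) {lo<..<hi - 4} \<union> lev (c + 1) (t ` {..<m'})))"
      proof (rule less.hyps)
        show "lev (c + 1) {lo<..<hi - 4} \<subseteq> Y - lev (c + 1) {hi - 3}"
          using subs(4) by (auto simp: lev_def)
        show "hi - 4 = s m' \<or> lev (c + 1) {hi - 4 + 1} \<inter> (Y - lev (c + 1) {hi - 3}) = {}"
          by simp
        show "nat (hi - 4 - lo) < nat (hi - lo)" using m' by simp
        show "above c (Y - lev (c + 1) {hi - 3})" using Y by (simp add: above_Diff)
        show "even (hi - 4 - lo)" using less.prems(4) by simp
        show "s m' \<le> hi - 4" using m' by simp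
        show "lo = s 0 \<or> lev (c + 1) {lo - 1} \<inter> (Y - lev (c + 1) {hi - 3}) = {}" using less.prems(8) by auto
      qed (use less.prems(2) inc par gap(2) in simp_all)
      moreover have "Y - lev (c + 1) {lo<..<hi} \<union> lev (c + 1) ((t(m' := hi - 1)) ` {..<m}) =
          Y - lev (c + 1) {hi - 3} - lev (c + 1) {lo<..<hi - 4} \<union> lev (c + 1) (t ` {..<m'})" for t
      proof -
        have "lev (c + 1) ((t(m' := hi - 1)) ` {..<m}) =
            lev (c + 1) {hi - 1} \<union> lev (c + 1) (t ` {..<m'})"
          unfolding gap(2) image_fun_upd_lessThan_Suc by (rule lev_insert)
        then show ?thesis using cut1 cut2 disj[of hi] subs(1) by auto
      qed
      ultimately show ?thesis by simp
    qed
    also have "num_tilings (Y - lev (c + 1) {hi - 1} \<union> lev c ?A) =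
        (\<Sum>y\<in>gap (s m') (hi - 2). \<Sum>t\<in>?P. ?h (t(m' := y)) m)"
    proof -
      have "lev c ?A = lev c ({lo..hi - 2} - ?s ` {..m})"
      proof (rule lev_cong)
        fix y assume "even (c + y)"
        with c_hi have "y \<noteq> hi - 3" by presburger
        then show "y \<in> ?A \<longleftrightarrow> y \<in> {lo..hi - 2} - ?s ` {..m}"
          unfolding im2 by auto
      qed
      then have "num_tilings (Y - lev (c + 1) {hi - 1} \<union> lev c ?A) =
          num_tilings (Y - lev (c + 1) {hi - 1} \<union> lev c ({lo..hi - 2} - ?s ` {..m}))" by simp
      also have "\<dots> = (\<Sum>t\<in>PiE {..<m} (\<lambda>i. gap (?s i) (?s (Suc i))).
          num_tilings (Y - lev (c + 1) {hi - 1} - lev (c + 1) {lo<..<hi - 2} \<union> lev (c + 1) (t ` {..<m})))"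
      proof (rule less.hyps)
        show "lev (c + 1) {lo<..<hi - 2} \<subseteq> Y - lev (c + 1) {hi - 1}"
          using disj[of hi] subs(3) by blast
        show "?s i < ?s (Suc i)" if "i < m" for i
          using that inc[OF that] gap by (cases "i = m'") auto
        show "even (?s i - lo)" if "i \<le> m" for i
          using par[OF that] c_hi2 c_lo by (cases "i = m") auto
        show "nat (hi - 2 - lo) < nat (hi - lo)" using m' by simp
        show "above c (Y - lev (c + 1) {hi - 1})" using Y by (simp add: above_Diff)
        show "even (hi - 2 - lo)" using less.prems(4) by simp
        show "(s(m := hi - 2)) m \<le> hi - 2" using m' by simp
        show "lo = (s(m := hi - 2)) 0 \<or> lev (c + 1) {lo - 1} \<inter> (Y - lev (c + 1) {hi - 1}) = {}" using less.prems(8) gap(2) by auto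
        show "lo \<le> ?s 0" using less.prems(2) gap(2) by simp
        show "hi - 2 = ?s m \<or> lev (c + 1) {hi - 2 + 1} \<inter> (Y - lev (c + 1) {hi - 1}) = {}" by simp
      qed
      also have "\<dots> = (\<Sum>t\<in>PiE (insert m' {..<m'}) (\<lambda>i. gap (?s i) (?s (Suc i))). ?h t m)"
      proof -
        have "Y - lev (c + 1) {hi - 1} - lev (c + 1) {lo<..<hi - 2} = Y - lev (c + 1) {lo<..<hi}"
          using cut1 by blast
        then show ?thesis by (simp add: gap(2) lessThan_Suc)
      qed
      also have "\<dots> = (\<Sum>y\<in>gap (?s m') (?s (Suc m')).
          \<Sum>t\<in>PiE {..<m'} (\<lambda>i. gap (?s i) (?s (Suc i))). ?h (t(m' := y)) m)"
        by (rule sum_PiE_insert) simp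
      also have "PiE {..<m'} (\<lambda>i. gap (?s i) (?s (Suc i))) = ?P"
        using gap(2) by (intro PiE_cong) auto
      also have "gap (?s m') (?s (Suc m')) = gap (s m') (hi - 2)" using gap(2) by simp
      finally show ?thesis .
    qed
    also have "(\<Sum>t\<in>?P. ?h (t(m' := hi - 1)) m) + (\<Sum>y\<in>gap (s m') (hi - 2). \<Sum>t\<in>?P. ?h (t(m' := y)) m) =
        (\<Sum>y\<in>gap (s m') (s (Suc m')). \<Sum>t\<in>?P. ?h (t(m' := y)) m)"
    proof -
      have "even (hi - 2 - s m')" using c_hi c_s[of m'] gap(2) by auto
      then have "gap (s m') (hi - 2 + 2) = insert (hi - 2 + 1) (gap (s m') (hi - 2))"
        using m'(1) by (intro gap_step) auto
      then have "gap (s m') (s (Suc m')) = insert (hi - 1) (gap (s m') (hi - 2))"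
        using gap(1,2) by simp
      moreover have "hi - 1 \<notin> gap (s m') (hi - 2)" by (simp add: gap_def)
      ultimately show ?thesis by simp
    qed
    also have "\<dots> = (\<Sum>t\<in>PiE {..<m} (\<lambda>i. gap (s i) (s (Suc i))). ?h t m)"
    proof -
      have "{..<m} = insert m' {..<m'}" using gap(2) by auto
      moreover have "(\<Sum>t\<in>PiE (insert m' {..<m'}) (\<lambda>i. gap (s i) (s (Suc i))). ?h t m) =
          (\<Sum>y\<in>gap (s m') (s (Suc m')). \<Sum>t\<in>?P. ?h (t(m' := y)) m)"
        by (rule sum_PiE_insert) simp
      ultimately show ?thesis by simp
    qed
    finally show ?thesis .
  qed
qed

section \<open>Two-step recursion between diagonals\<close>

text \<open>Level \<open>c\<close> itself is left out, so that a partly used level can be added with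
  \<open>lev\<close>. The order \<open>n\<close> bounds both level and position, as two sides of the
  Aztec diamond are \<open>a + b < n\<close> and \<open>b - a \<le> n\<close>.\<close>

definition stack :: "int \<Rightarrow> (int \<Rightarrow> int) \<Rightarrow> int \<Rightarrow> region" where
  "stack n w c = {(a, b). c < a + b \<and> a + b < n \<and> w (a + b) \<le> b - a \<and> b - a \<le> n}"

lemma stack_pred: "c < n \<Longrightarrow> stack n w (c - 1) = stack n w c \<union> lev c {w c..n}"
proof -
  assume "c < n"
  then have "p \<in> stack n w (c - 1) \<longleftrightarrow> p \<in> stack n w c \<union> lev c {w c..n}" for p
    by (cases p; cases "fst p + snd p = c") (auto simp: stack_def lev_def)
  then show ?thesis by blast
qed

lemma stack_Int_lev: "stack n w c \<inter> lev c A = {}"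
  by (auto simp: stack_def lev_def)

lemma above_stack: "above c (stack n w c)"
proof -
  \<comment> \<open>A common lower bound of the wall on finitely many levels, needed only for
    finiteness.\<close>
  define M where "M = Min (w ` {c..n})"
  have "(a, b) \<in> (\<lambda>(d, x). ((d - x) div 2, (d + x) div 2)) ` ({c..n} \<times> {M..n})"
    if "(a, b) \<in> stack n w c" for a b
  proof (rule image_eqI)
    show "(a, b) = (case (a + b, b - a) of (d, x) \<Rightarrow> ((d - x) div 2, (d + x) div 2))" by simp
    have "M \<le> w (a + b)" unfolding M_def using that by (intro Min_le) (auto simp: stack_def)
    with that show "(a + b, b - a) \<in> {c..n} \<times> {M..n}" by (auto simp: stack_def)
  qed
  then have "stack n w c \<subseteq> (\<lambda>(d, x). ((d - x) div 2, (d + x) div 2)) ` ({c..n} \<times> {M..n})"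
    by auto
  then have "finite (stack n w c)" by (rule finite_subset) simp
  then show ?thesis by (auto simp: above_def stack_def)
qed

definition valid :: "int \<Rightarrow> (int \<Rightarrow> int) \<Rightarrow> int \<Rightarrow> nat \<Rightarrow> (nat \<Rightarrow> int) \<Rightarrow> bool" where
  "valid n w c m t \<longleftrightarrow> (\<forall>i<m. even (c + t i) \<and> w c \<le> t i \<and> t i \<le> n) \<and>
    (\<forall>i. Suc i < m \<longrightarrow> t i < t (Suc i))"

lemma valid_less:
  assumes "valid n w c m t" "i < j" "j < m"
  shows "t i < t j"
  using assms(2,3)
proof (induction j)
  case (Suc j)
  then show ?case using assms(1) by (cases "i = j") (fastforce simp: valid_def)+
qed simp

lemma valid_inj: "valid n w c m t \<Longrightarrow> inj_on t {..<m}"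
  by (rule linorder_inj_onI) (auto dest: valid_less)

text \<open>The product of the reciprocal leading coefficients picked up in the interlacing steps.\<close>

definition coef :: "nat \<Rightarrow> nat \<Rightarrow> real" where
  "coef e m = (\<Prod>k<m. 1 / fact (2 * k)) / (\<Prod>j<m. real (2 * j + 1) ^ e)"

lemma prod_odd_even_fact: "(\<Prod>j<m. real (2 * j + 1) * real (2 * j + 2)) = fact (2 * m)"
  by (induction m) (simp_all add: algebra_simps)

text \<open>Passing to \<open>Suc m\<close> brings in the factorial of \<open>2 * m\<close>. Its odd
  factors form the denominator of \<open>coef 1 m\<close>, its even factors come from the
  interlacing sum, and \<open>2 ^ m\<close> cancels the factors 2 there.\<close>

lemma coef_0_Suc: "coef 0 (Suc m) = 2 ^ m * coef 1 m / (\<Prod>j<m. 2 * real (2 * j + 2))"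
  unfolding coef_def prod.distrib prod_odd_even_fact[symmetric]
  by (simp add: prod.distrib field_simps)

lemma coef_1: "coef 1 m = 2 ^ m * coef 0 m / (\<Prod>j<m. 2 * real (2 * j + 1))"
  unfolding coef_def prod.distrib by (simp add: field_simps)

text \<open>\<open>t\<close> lists the cells of level \<open>c\<close> still to be matched upwards.
  The factor \<open>2 ^ m\<close> and the wall weights are those of the unit-step sum by which a
  particle level arises from the hole level above it.\<close>

definition particle_inv :: "int \<Rightarrow> (int \<Rightarrow> int) \<Rightarrow> int \<Rightarrow> nat \<Rightarrow> nat \<Rightarrow> bool" where
  "particle_inv n w c e m \<longleftrightarrow> (\<forall>t. valid n w c m t \<longrightarrow>
    real (num_tilings (stack n w c \<union> lev c (t ` {..<m}))) =
    2 ^ m * coef e m * ((\<Prod>i<m. wall_weight e (t i)) * alternant m e t))"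

text \<open>\<open>s\<close> lists the cells of level \<open>c\<close> already used from below; all
  others are to be matched upwards.\<close>

definition hole_inv :: "int \<Rightarrow> (int \<Rightarrow> int) \<Rightarrow> int \<Rightarrow> nat \<Rightarrow> nat \<Rightarrow> bool" where
  "hole_inv n w c e m \<longleftrightarrow> (\<forall>s. valid n w c m s \<longrightarrow>
    real (num_tilings (stack n w c \<union> lev c ({w c..n} - s ` {..<m}))) = coef e m * alternant m e s)"

text \<open>Nothing lies above level \<open>n - 1\<close>, and the empty alternant is 1 for either
  \<open>e\<close>; the recursion may start with whichever \<open>e\<close> fits the wall.\<close>

lemma particle_inv_top: "particle_inv n w (n - 1) e 0"
proof -
  have "stack n w (n - 1) = {}" by (auto simp: stack_def)
  then show ?thesis
    by (simp add: particle_inv_def coef_def alternant_eq_prod num_tilings_empty)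
qed

text \<open>Particles on level \<open>c - 1\<close> take away cells of level \<open>c\<close>, which
  become its holes. The sum over admissible moves extends to all moves to nonnegative positions, the
  extra ones having alternant 0, and then the unit-step formula applies.\<close>

lemma particle_step:
  assumes inv: "hole_inv n w c e m" and c: "c < n" "even (n + c)" "even (w c + c)"
    and w: "e = 0 \<and> (w c = 0 \<and> w (c - 1) = 1 \<or> w c = 1 \<and> w (c - 1) = 0) \<or>
      e = 1 \<and> (w c = 2 \<and> w (c - 1) = 1 \<or> w c = 1 \<and> w (c - 1) = 2)"
  shows "particle_inv n w (c - 1) e m"
  unfolding particle_inv_def
proof (intro allI impI)
  fix t assume t: "valid n w (c - 1) m t"
  \<comment> \<open>\<open>n\<close> has the parity of level \<open>c\<close>, so no particle of
    level \<open>c - 1\<close> sits at \<open>n\<close> and the upper boundary excludes no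
    move.\<close>
  have ti: "odd (c + t i)" "w (c - 1) \<le> t i" "t i + 1 \<le> n" if "i < m" for i
  proof -
    show odd: "odd (c + t i)" and "w (c - 1) \<le> t i" using t that by (auto simp: valid_def)
    have "t i \<le> n" using t that by (auto simp: valid_def)
    moreover have "t i \<noteq> n" using odd c(2) by auto
    ultimately show "t i + 1 \<le> n" by simp
  qed
  let ?X = "stack n w (c - 1)"
  let ?B = "\<lambda>i. {t i - 1, t i + 1}"
  let ?F = "\<lambda>u. if inj_on u {..<m} \<and> lev c (u ` {..<m}) \<subseteq> ?X
      then real (num_tilings (?X - lev c (u ` {..<m}))) else 0"
  have X: "?X = stack n w c \<union> lev c {w c..n}" by (rule stack_pred) fact
  have sub_iff: "lev c (u ` {..<m}) \<subseteq> ?X \<longleftrightarrow> (\<forall>i<m. u i \<in> {w c..n})"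
    if u: "u \<in> PiE {..<m} ?B" for u
  proof -
    have mem: "lev c {u i} \<subseteq> ?X \<longleftrightarrow> u i \<in> {w c..n}" if "i < m" for i
    proof -
      have "u i \<in> ?B i" using u that by auto
      then have "even (c + u i)" using ti(1)[OF that] by auto
      then have "lev c {u i} \<noteq> {}" by (simp add: lev_single)
      then show ?thesis unfolding X by (auto simp: lev_def stack_def)
    qed
    have "lev c (u ` {..<m}) = (\<Union>i<m. lev c {u i})" by (auto simp: lev_def)
    then show ?thesis using mem by (auto simp: UN_subset_iff)
  qed
  have F: "?F u = coef e m * alternant m e u"
    if u: "u \<in> PiE {..<m} (\<lambda>i. {y \<in> ?B i. 0 \<le> y})" for u
  proof -
    have uB: "u \<in> PiE {..<m} ?B" using u by (auto simp: PiE_iff)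
    have ui: "u i \<in> ?B i" "0 \<le> u i" "even (c + u i)" if "i < m" for i
    proof -
      have "u i \<in> {y \<in> ?B i. 0 \<le> y}" using u that by (auto simp: PiE_iff)
      then show "u i \<in> ?B i" "0 \<le> u i" "even (c + u i)" using ti(1)[OF that] by auto
    qed
    consider (bad) "\<not> inj_on u {..<m}" | (out) i where "i < m" "u i \<notin> {w c..n}"
      | (good) "inj_on u {..<m}" "\<forall>i<m. u i \<in> {w c..n}" by blast
    then show ?thesis
    proof cases
      case bad
      then show ?thesis by (simp add: alternant_eq_0_if_not_inj)
    next
      case out
      \<comment> \<open>By parity, a nonnegative target below the wall can only be 0 under a wall at
        2; there \<open>e = 1\<close> and the alternant vanishes.\<close>
      have "u i < w c" using out ui(1)[OF out(1)] ti(3)[OF out(1)] by auto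
      moreover have "t i - 1 \<le> u i" using ui(1)[OF out(1)] by auto
      moreover have "x = 0 \<and> e = 1"
        if "x < v" "y - 1 \<le> x" "0 \<le> x" "even (c + x)" "v' \<le> y" "even (v + c)"
          "e = 0 \<and> (v = 0 \<and> v' = 1 \<or> v = 1 \<and> v' = 0) \<or> e = 1 \<and> (v = 2 \<and> v' = 1 \<or> v = 1 \<and> v' = 2)"
        for x y v v' :: int
        using that by presburger
      ultimately have "u i = 0 \<and> e = 1"
        using w ui(2,3)[OF out(1)] ti(2)[OF out(1)] c(3) by blast
      then have "alternant m e u = 0" using out(1) by (intro alternant_eq_0_if_zero) auto
      moreover have "\<not> lev c (u ` {..<m}) \<subseteq> ?X" using out sub_iff[OF uB] by blast
      ultimately show ?thesis by simp
    next
      case good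
      have "valid n w c m u"
        unfolding valid_def
      proof (intro conjI allI impI)
        fix i assume i: "Suc i < m"
        have "t i < t (Suc i)" using t i by (auto simp: valid_def)
        moreover have "even (t i + t (Suc i))" using ti(1)[of i] ti(1)[of "Suc i"] i by auto
        ultimately have "t i + 2 \<le> t (Suc i)" by presburger
        then have "u i \<le> u (Suc i)" using ui(1)[of i] ui(1)[of "Suc i"] i by auto
        moreover have "u i \<noteq> u (Suc i)" using inj_onD[OF good(1), of i "Suc i"] i by auto
        ultimately show "u i < u (Suc i)" by simp
      qed (use good(2) ui in auto)
      then have "real (num_tilings (stack n w c \<union> lev c ({w c..n} - u ` {..<m}))) = coef e m * alternant m e u"
        using inv by (auto simp: hole_inv_def)
      moreover have "?X - lev c (u ` {..<m}) = stack n w c \<union> lev c ({w c..n} - u ` {..<m})"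
        unfolding X lev_Diff using stack_Int_lev[of n w c "u ` {..<m}"] by blast
      ultimately show ?thesis using good sub_iff[OF uB] by simp
    qed
  qed
  have "real (num_tilings (?X \<union> lev (c - 1) (t ` {..<m}))) = (\<Sum>u\<in>PiE {..<m} ?B. ?F u)"
    using num_tilings_unit_steps[OF above_stack[of "c - 1" n w] valid_inj[OF t]] ti(1)
    by (simp add: if_distrib cong: if_cong)
  \<comment> \<open>Negative targets lie below the wall and already count zero.\<close>
  also have "\<dots> = (\<Sum>u\<in>PiE {..<m} (\<lambda>i. {y \<in> ?B i. 0 \<le> y}). ?F u)"
  proof (rule sum.mono_neutral_right)
    show "\<forall>u\<in>PiE {..<m} ?B - PiE {..<m} (\<lambda>i. {y \<in> ?B i. 0 \<le> y}). ?F u = 0"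
    proof
      fix u assume u: "u \<in> PiE {..<m} ?B - PiE {..<m} (\<lambda>i. {y \<in> ?B i. 0 \<le> y})"
      then obtain i where "i < m" "u i < 0" by (fastforce simp: PiE_iff)
      moreover have "0 \<le> w c" using w by auto
      ultimately have "\<not> lev c (u ` {..<m}) \<subseteq> ?X" using u sub_iff[of u] by force
      then show "?F u = 0" by simp
    qed
  qed (auto intro!: finite_PiE)
  also have "\<dots> = coef e m * (\<Sum>u\<in>PiE {..<m} (\<lambda>i. {y \<in> ?B i. 0 \<le> y}). alternant m e u)"
    unfolding sum_distrib_left by (rule sum.cong[OF refl F])
  also have "\<dots> = coef e m * (2 ^ m * ((\<Prod>i<m. wall_weight e (t i)) * alternant m e t))"
  proof (subst sum_unit_steps_alternant)
    show "int e \<le> t i" if "i < m" for i using w ti(2)[OF that] by auto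
  qed (use w in auto)
  finally show "real (num_tilings (?X \<union> lev (c - 1) (t ` {..<m}))) =
      2 ^ m * coef e m * ((\<Prod>i<m. wall_weight e (t i)) * alternant m e t)" by simp
qed

text \<open>Levels \<open>c - 1\<close> and \<open>c\<close> form a path with both ends on level
  \<open>c - 1\<close>: its wall is one lower and \<open>n\<close> has its parity. Hence
  \<open>Suc m\<close> holes leave \<open>m\<close> interlacing particles, and the odd alternants
  add up to an even one.\<close>

lemma hole_step_grow:
  assumes inv: "particle_inv n w c 1 m" and c: "c < n" "odd (n + c)" "even (w c + c)"
    and w: "w c = w (c - 1) + 1"
  shows "hole_inv n w (c - 1) 0 (Suc m)"
  unfolding hole_inv_def
proof (intro allI impI)
  fix s assume s: "valid n w (c - 1) (Suc m) s"
  let ?X = "stack n w (c - 1)" and ?lo = "w (c - 1)"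
  let ?P = "PiE {..<m} (\<lambda>i. gap (s i) (s (Suc i)))"
  have X: "?X = stack n w c \<union> lev c {w c..n}" by (rule stack_pred) fact
  have si: "odd (c + s i)" "?lo \<le> s i" "s i \<le> n" if "i \<le> m" for i
  proof -
    have "even (c - 1 + s i) \<and> ?lo \<le> s i \<and> s i \<le> n"
      using s that unfolding valid_def by (metis less_Suc_eq_le)
    then show "odd (c + s i)" "?lo \<le> s i" "s i \<le> n" by auto
  qed
  have inc: "s i < s (Suc i)" if "i < m" for i using s that by (auto simp: valid_def)
  \<comment> \<open>Position \<open>n\<close> has the wrong parity on level \<open>c\<close>, so
    excluding it changes nothing.\<close>
  have cut: "lev c {?lo<..<n} = lev c {w c..n}"
    using c(2) by (intro lev_cong) (auto simp: w le_less)
  have "num_tilings (?X \<union> lev (c - 1) ({?lo..n} - s ` {..m})) =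
      (\<Sum>t\<in>?P. num_tilings (?X - lev (c - 1 + 1) {?lo<..<n} \<union> lev (c - 1 + 1) (t ` {..<m})))"
  proof (rule num_tilings_interlacing)
    show "above (c - 1) ?X" by (rule above_stack)
    show "even (c - 1 + ?lo)" "even (n - ?lo)" using c w by auto
    show "even (s i - ?lo)" if "i \<le> m" for i using si(1)[OF that] c(3) w by auto
    show "lev (c - 1 + 1) {?lo<..<n} \<subseteq> ?X" using cut X by simp
    show "?lo = s 0 \<or> lev (c - 1 + 1) {?lo - 1} \<inter> ?X = {}" using w by (auto simp: stack_def lev_def)
    show "n = s m \<or> lev (c - 1 + 1) {n + 1} \<inter> ?X = {}" by (auto simp: stack_def lev_def)
  qed (use si inc in auto)
  moreover have "?X - lev c {?lo<..<n} = stack n w c"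
    unfolding cut X using stack_Int_lev[of n w c "{w c..n}"] by blast
  ultimately have "real (num_tilings (?X \<union> lev (c - 1) ({?lo..n} - s ` {..m}))) =
      (\<Sum>t\<in>?P. real (num_tilings (stack n w c \<union> lev c (t ` {..<m}))))" by simp
  also have "\<dots> = (\<Sum>t\<in>?P. 2 ^ m * coef 1 m * ((\<Prod>i<m. wall_weight 1 (t i)) * alternant m 1 t))"
  proof (intro sum.cong refl)
    fix t assume t: "t \<in> ?P"
    have ti: "s i < t i" "t i < s (Suc i)" "even (c + t i)" if "i < m" for i
    proof -
      have "t i \<in> gap (s i) (s (Suc i))" using t that by auto
      then show "s i < t i" "t i < s (Suc i)" "even (c + t i)"
        using si(1)[of i] that by (auto simp: gap_def)
    qed
    have "valid n w c m t"
      unfolding valid_def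
    proof (intro conjI allI impI)
      fix i assume i: "i < m"
      show "even (c + t i)" using ti i by simp
      show "w c \<le> t i" using ti(1)[OF i] si(2)[of i] i w by simp
      show "t i \<le> n" using ti(2)[OF i] si(3)[of "Suc i"] i by simp
    next
      fix i assume "Suc i < m"
      then show "t i < t (Suc i)" using ti(2)[of i] ti(1)[of "Suc i"] by simp
    qed
    then show "real (num_tilings (stack n w c \<union> lev c (t ` {..<m}))) =
        2 ^ m * coef 1 m * ((\<Prod>i<m. wall_weight 1 (t i)) * alternant m 1 t)"
      using inv by (auto simp: particle_inv_def)
  qed
  also have "\<dots> = 2 ^ m * coef 1 m * (alternant (Suc m) 0 s / (\<Prod>j<m. 2 * real (2 * j + 2)))"
    unfolding sum_distrib_left[symmetric]
  proof (subst sum_interlacing_odd_alternant)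
    fix i assume i: "i < m"
    have "even (s (Suc i) - s i)" using si(1)[of i] si(1)[of "Suc i"] i by auto
    then show "s i \<le> s (Suc i) \<and> even (s (Suc i) - s i)" using inc[OF i] by simp
  qed simp
  finally show "real (num_tilings (?X \<union> lev (c - 1) ({?lo..n} - s ` {..<Suc m}))) =
      coef 0 (Suc m) * alternant (Suc m) 0 s"
    by (simp only: coef_0_Suc lessThan_Suc_atMost) simp
qed

text \<open>Here the missing positions are preceded by the fictitious position \<open>w c - 1\<close>, which lies
  below the wall of level \<open>c - 1\<close>.\<close>

lemma hole_step_keep:
  assumes inv: "particle_inv n w c 0 m" and c: "c < n" "odd (n + c)" "even (w c + c)"
    and w: "w (c - 1) = w c + 1" "w c = 0 \<or> w c = 1" and n: "0 \<le> n"
  shows "hole_inv n w (c - 1) 1 m"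
  unfolding hole_inv_def
proof (intro allI impI)
  fix s assume s: "valid n w (c - 1) m s"
  let ?X = "stack n w (c - 1)" and ?lo = "w c - 1"
  define s' where "s' i = (case i of 0 \<Rightarrow> ?lo | Suc i \<Rightarrow> s i)" for i
  let ?P = "PiE {..<m} (\<lambda>i. gap (s' i) (s' (Suc i)))"
  have X: "?X = stack n w c \<union> lev c {w c..n}" by (rule stack_pred) fact
  have si: "odd (c + s i)" "w c + 1 \<le> s i" "s i \<le> n" if "i < m" for i
    using s that w by (auto simp: valid_def)
  have s'0: "s' 0 = ?lo" and s'_Suc: "s' (Suc i) = s i" for i by (simp_all add: s'_def)
  have s'_odd: "odd (c + s' i)" and s'_le: "s' i \<le> n" if "i \<le> m" for i
    using that si[of "i - 1"] c(3) n w(2) by (cases i; auto simp: s'_def)+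
  have inc: "s' i < s' (Suc i)" if "i < m" for i
  proof (cases i)
    case 0
    then show ?thesis using si(2)[of 0] that by (simp add: s'_def)
  next
    case (Suc j)
    then show ?thesis using s that by (auto simp: valid_def s'_def)
  qed
  have cut: "lev c {?lo<..<n} = lev c {w c..n}"
    using c(2) by (intro lev_cong) (auto simp: le_less)
  \<comment> \<open>Position \<open>w c\<close> has the wrong parity on level \<open>c - 1\<close>,
    so the fictitious hole \<open>w c - 1\<close> makes up exactly for the different lower
    ends.\<close>
  have "lev (c - 1) ({w (c - 1)..n} - s ` {..<m}) = lev (c - 1) ({?lo..n} - s' ` {..m})"
  proof (rule lev_cong)
    fix y assume y: "even (c - 1 + y)"
    have "{..m} = insert 0 (Suc ` {..<m})"
      by (simp add: image_Suc_lessThan atMost_atLeast0 atLeastAtMost_insertL flip: atLeastLessThanSuc_atLeastAtMost)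
        auto
    then have "s' ` {..m} = insert ?lo (s ` {..<m})"
      by (simp add: s'0 s'_Suc image_image)
    moreover have "y \<noteq> w c" using y c(3) by auto
    ultimately show "y \<in> {w (c - 1)..n} - s ` {..<m} \<longleftrightarrow> y \<in> {?lo..n} - s' ` {..m}"
      using w(1) by auto
  qed
  moreover have "num_tilings (?X \<union> lev (c - 1) ({?lo..n} - s' ` {..m})) =
      (\<Sum>t\<in>?P. num_tilings (?X - lev (c - 1 + 1) {?lo<..<n} \<union> lev (c - 1 + 1) (t ` {..<m})))"
  proof (rule num_tilings_interlacing)
    show "above (c - 1) ?X" by (rule above_stack)
    show "even (c - 1 + ?lo)" "even (n - ?lo)" using c by auto
    show "even (s' i - ?lo)" if "i \<le> m" for i using s'_odd[OF that] c(3) by auto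
    show "lev (c - 1 + 1) {?lo<..<n} \<subseteq> ?X" using cut X by simp
    show "?lo = s' 0 \<or> lev (c - 1 + 1) {?lo - 1} \<inter> ?X = {}" using s'0 by simp
    show "n = s' m \<or> lev (c - 1 + 1) {n + 1} \<inter> ?X = {}" by (auto simp: stack_def lev_def)
  qed (use s'0 s'_le inc in auto)
  moreover have "?X - lev c {?lo<..<n} = stack n w c"
    unfolding cut X using stack_Int_lev[of n w c "{w c..n}"] by blast
  ultimately have "real (num_tilings (?X \<union> lev (c - 1) ({w (c - 1)..n} - s ` {..<m}))) =
      (\<Sum>t\<in>?P. real (num_tilings (stack n w c \<union> lev c (t ` {..<m}))))" by simp
  also have "\<dots> = (\<Sum>t\<in>?P. 2 ^ m * coef 0 m * ((\<Prod>i<m. wall_weight 0 (t i)) * alternant m 0 t))"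
  proof (intro sum.cong refl)
    fix t assume t: "t \<in> ?P"
    have ti: "s' i < t i" "t i < s' (Suc i)" "even (c + t i)" if "i < m" for i
    proof -
      have "t i \<in> gap (s' i) (s' (Suc i))" using t that by auto
      then show "s' i < t i" "t i < s' (Suc i)" "even (c + t i)"
        using s'_odd[of i] that by (auto simp: gap_def)
    qed
    have s'_ge: "?lo \<le> s' i" if "i \<le> m" for i
      using that si(2)[of "i - 1"] by (cases i) (auto simp: s'_def)
    have "valid n w c m t"
      unfolding valid_def
    proof (intro conjI allI impI)
      fix i assume i: "i < m"
      show "even (c + t i)" using ti i by simp
      show "w c \<le> t i" using ti(1)[OF i] s'_ge[of i] i by simp
      show "t i \<le> n" using ti(2)[OF i] s'_le[of "Suc i"] i by simp
    next
      fix i assume "Suc i < m"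
      then show "t i < t (Suc i)" using ti(2)[of i] ti(1)[of "Suc i"] by simp
    qed
    then show "real (num_tilings (stack n w c \<union> lev c (t ` {..<m}))) =
        2 ^ m * coef 0 m * ((\<Prod>i<m. wall_weight 0 (t i)) * alternant m 0 t)"
      using inv by (auto simp: particle_inv_def)
  qed
  also have "\<dots> = 2 ^ m * coef 0 m * (alternant m 1 (\<lambda>i. s' (Suc i)) / (\<Prod>j<m. 2 * real (2 * j + 1)))"
    unfolding sum_distrib_left[symmetric]
  proof (subst sum_interlacing_even_alternant)
    fix i assume i: "i < m"
    have "even (s' (Suc i) - s' i)" using s'_odd[of i] s'_odd[of "Suc i"] i by auto
    then show "s' i \<le> s' (Suc i) \<and> even (s' (Suc i) - s' i)" using inc[OF i] by simp
  next
    \<comment> \<open>The fictitious hole sits at -1 or 0, the two cases in which its boundary term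
      vanishes.\<close>
    show "s' 0 = 0 \<or> s' 0 = - 1" using s'0 w(2) by auto
    show "0 \<le> s' i" if "0 < i" "i \<le> m" for i
      using that si(2)[of "i - 1"] w(2) by (cases i) (auto simp: s'_def)
  qed simp
  finally show "real (num_tilings (?X \<union> lev (c - 1) ({w (c - 1)..n} - s ` {..<m}))) =
      coef 1 m * alternant m 1 s"
    by (simp only: coef_1 s'_Suc) simp
qed

section \<open>The quartered Aztec diamonds\<close>

text \<open>The pattern 0, 1, 2, 1 of lowest positions traces a zigzag with steps of length 2. The
  phase \<open>\<phi>\<close> is 0 for \<open>R\<close> and \<open>K_a\<close>, and 2 for the
  mirrored \<open>K_na\<close>.\<close>

definition wall :: "int \<Rightarrow> int \<Rightarrow> int" where
  "wall \<phi> c = (if (c + \<phi>) mod 4 = 0 then 0 else if (c + \<phi>) mod 4 = 2 then 2 else 1)"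

lemma ceiling_half: "\<lceil>real_of_int a / 2\<rceil> = (a + 1) div 2"
proof -
  have "\<lceil>real_of_int a / real_of_int 2\<rceil> = - ((- a) div 2)"
    by (rule ceiling_divide_eq_div[unfolded of_int_numeral])
  also have "\<dots> = (a + 1) div 2" by presburger
  finally show ?thesis by simp
qed

lemma aztec_diamond_iff:
  "(a, b) \<in> aztec_diamond n \<longleftrightarrow>
    a + b + 1 \<le> int n \<and> - a - b - 1 \<le> int n \<and> b - a \<le> int n \<and> a - b \<le> int n"
proof -
  define R where "R = \<bar>2 * a + 1\<bar> + \<bar>2 * b + 1\<bar>"
  have R: "\<bar>real_of_int a + 1 / 2\<bar> + \<bar>real_of_int b + 1 / 2\<bar> = real_of_int R / 2"
    by (simp add: R_def abs_if field_simps)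
  have "(a, b) \<in> aztec_diamond n \<longleftrightarrow> real_of_int R / 2 \<le> real n"
    unfolding aztec_diamond_def mem_Collect_eq case_prod_conv R ..
  also have "\<dots> \<longleftrightarrow> real_of_int R \<le> real_of_int (2 * int n)" by auto
  also have "\<dots> \<longleftrightarrow> R \<le> 2 * int n" by (simp only: of_int_le_iff)
  also have "\<dots> \<longleftrightarrow> a + b + 1 \<le> int n \<and> - a - b - 1 \<le> int n \<and> b - a \<le> int n \<and> a - b \<le> int n"
    unfolding R_def by linarith
  finally show ?thesis .
qed

text \<open>Here \<open>k\<close> is the ceiling of \<open>a / 2\<close> and \<open>r\<close> the
  residue of the diagonal. In each of the eight cases for \<open>r\<close> and
  \<open>\<delta>\<close>, ceilings become affine in \<open>q\<close> and \<open>k\<close>, and wall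
  and residue become constants, so linear arithmetic can decide the descriptions of the
  regions.\<close>

lemma cell_mod_cases:
  fixes a b :: int
  obtains q k r \<delta> where "a = 2 * k - \<delta>" "b = 4 * q + r - 2 * k + \<delta>" "r = 0 \<or> r = 1 \<or> r = 2 \<or> r = 3"
    "\<delta> = 0 \<or> \<delta> = 1" "(a + 1) div 2 = k" "(b + 1) div 2 = 2 * q - k + (r + \<delta> + 1) div 2"
    "wall 0 (a + b) = (if r = 0 then 0 else if r = 2 then 2 else 1)"
    "wall 2 (a + b) = (if r = 0 then 2 else if r = 2 then 0 else 1)"
    "(b - a) mod 4 = (r + 2 * \<delta>) mod 4"
proof (rule that)
  define k \<delta> q r where "k = (a + 1) div 2" and "\<delta> = 2 * ((a + 1) div 2) - a"
    and "q = (a + b) div 4" and "r = (a + b) mod 4"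
  note defs = this
  show "a = 2 * k - \<delta>" "(a + 1) div 2 = k" by (simp_all add: defs)
  show b: "b = 4 * q + r - 2 * k + \<delta>" by (simp add: defs)
  show "r = 0 \<or> r = 1 \<or> r = 2 \<or> r = 3" "\<delta> = 0 \<or> \<delta> = 1" unfolding defs by presburger+
  show "(b + 1) div 2 = 2 * q - k + (r + \<delta> + 1) div 2" unfolding b by presburger
  show "wall 0 (a + b) = (if r = 0 then 0 else if r = 2 then 2 else 1)" by (simp add: wall_def defs)
  have "(a + b + 2) mod 4 = 0 \<longleftrightarrow> r = 2" "(a + b + 2) mod 4 = 2 \<longleftrightarrow> r = 0"
    unfolding defs by presburger+
  then show "wall 2 (a + b) = (if r = 0 then 2 else if r = 2 then 0 else 1)" by (auto simp: wall_def)
  show "(b - a) mod 4 = (r + 2 * \<delta>) mod 4" unfolding defs by presburger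
qed

text \<open>The region ends at diagonal -1, of which the zigzag keeps only every second cell; this
  prescribes the bottom configuration.\<close>

lemma quartered_Ka_eq:
  "quartered_Ka n = stack (int n) (wall 0) (- 1) \<union> lev (- 1) {x. x mod 4 = 1 \<and> 1 \<le> x \<and> x \<le> int n}"
proof -
  have iff: "(a + b + 1 \<le> N \<and> - a - b - 1 \<le> N \<and> b - a \<le> N \<and> a - b \<le> N) \<and> 2 * ((a + 1) div 2) \<le> b \<and> - 2 * ((a + 1) div 2) \<le> b \<longleftrightarrow>
      - 1 < a + b \<and> a + b < N \<and> wall 0 (a + b) \<le> b - a \<and> b - a \<le> N \<or>
      a + b = - 1 \<and> (b - a) mod 4 = 1 \<and> 1 \<le> b - a \<and> b - a \<le> N" for a b N :: int
  proof (cases rule: cell_mod_cases[of a b])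
    case (1 q k r \<delta>)
    show ?thesis
      unfolding 1(5-9) unfolding 1(1,2) using 1(3,4)
      by (elim disjE; hypsubst; simp; safe; (linarith | presburger))
  qed
  have "(a, b) \<in> quartered_Ka n \<longleftrightarrow>
      (a + b + 1 \<le> int n \<and> - a - b - 1 \<le> int n \<and> b - a \<le> int n \<and> a - b \<le> int n) \<and> 2 * ((a + 1) div 2) \<le> b \<and> - 2 * ((a + 1) div 2) \<le> b" for a b
    by (auto simp: quartered_Ka_def aztec_diamond_iff ceiling_half)
  moreover have "(a, b) \<in> stack (int n) (wall 0) (- 1) \<union> lev (- 1) {x. x mod 4 = 1 \<and> 1 \<le> x \<and> x \<le> int n} \<longleftrightarrow>
      - 1 < a + b \<and> a + b < int n \<and> wall 0 (a + b) \<le> b - a \<and> b - a \<le> int n \<or>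
      a + b = - 1 \<and> (b - a) mod 4 = 1 \<and> 1 \<le> b - a \<and> b - a \<le> int n" for a b
    by (simp add: stack_def lev_def)
  ultimately show ?thesis
    by (intro equalityI subrelI) (simp_all only: iff)
qed

text \<open>Only the residue on the bottom diagonal distinguishes this region from
  \<open>K_a\<close>; the vanishing result exploits this.\<close>

lemma quartered_R_eq:
  "quartered_R n = stack (int n) (wall 0) (- 1) \<union> lev (- 1) {x. x mod 4 = 3 \<and> 1 \<le> x \<and> x \<le> int n}"
proof -
  have iff: "(a + b + 1 \<le> N \<and> - a - b - 1 \<le> N \<and> b - a \<le> N \<and> a - b \<le> N) \<and> 2 * ((a + 1) div 2) \<le> b \<and> - 2 * ((b + 1) div 2) \<le> a \<longleftrightarrow>
      - 1 < a + b \<and> a + b < N \<and> wall 0 (a + b) \<le> b - a \<and> b - a \<le> N \<or>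
      a + b = - 1 \<and> (b - a) mod 4 = 3 \<and> 1 \<le> b - a \<and> b - a \<le> N" for a b N :: int
  proof (cases rule: cell_mod_cases[of a b])
    case (1 q k r \<delta>)
    show ?thesis
      unfolding 1(5-9) unfolding 1(1,2) using 1(3,4)
      by (elim disjE; hypsubst; simp; safe; (linarith | presburger))
  qed
  have "(a, b) \<in> quartered_R n \<longleftrightarrow>
      (a + b + 1 \<le> int n \<and> - a - b - 1 \<le> int n \<and> b - a \<le> int n \<and> a - b \<le> int n) \<and> 2 * ((a + 1) div 2) \<le> b \<and> - 2 * ((b + 1) div 2) \<le> a" for a b
    by (auto simp: quartered_R_def aztec_diamond_iff ceiling_half)
  moreover have "(a, b) \<in> stack (int n) (wall 0) (- 1) \<union> lev (- 1) {x. x mod 4 = 3 \<and> 1 \<le> x \<and> x \<le> int n} \<longleftrightarrow>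
      - 1 < a + b \<and> a + b < int n \<and> wall 0 (a + b) \<le> b - a \<and> b - a \<le> int n \<or>
      a + b = - 1 \<and> (b - a) mod 4 = 3 \<and> 1 \<le> b - a \<and> b - a \<le> int n" for a b
    by (simp add: stack_def lev_def)
  ultimately show ?thesis
    by (intro equalityI subrelI) (simp_all only: iff)
qed

text \<open>Reflection in the line \<open>a = b\<close> brings the piece to the side
  \<open>b - a \<ge> 0\<close>; its cut is the same zigzag shifted by two diagonals.\<close>

lemma swap_quartered_Kna_eq:
  "prod.swap ` quartered_Kna n = stack (int n) (wall 2) (- 1) \<union> lev (- 1) {x. x mod 4 = 3 \<and> 1 \<le> x \<and> x \<le> int n}"
proof -
  have iff: "(a + b + 1 \<le> N \<and> - a - b - 1 \<le> N \<and> b - a \<le> N \<and> a - b \<le> N) \<and> - 2 * ((b + 1) div 2) \<le> a \<and> a \<le> 2 * ((b + 1) div 2) - 1 \<longleftrightarrow>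
      - 1 < a + b \<and> a + b < N \<and> wall 2 (a + b) \<le> b - a \<and> b - a \<le> N \<or>
      a + b = - 1 \<and> (b - a) mod 4 = 3 \<and> 1 \<le> b - a \<and> b - a \<le> N" for a b N :: int
  proof (cases rule: cell_mod_cases[of a b])
    case (1 q k r \<delta>)
    show ?thesis
      unfolding 1(5-9) unfolding 1(1,2) using 1(3,4)
      by (elim disjE; hypsubst; simp; safe; (linarith | presburger))
  qed
  have "(a, b) \<in> prod.swap ` quartered_Kna n \<longleftrightarrow>
      (a + b + 1 \<le> int n \<and> - a - b - 1 \<le> int n \<and> b - a \<le> int n \<and> a - b \<le> int n) \<and> - 2 * ((b + 1) div 2) \<le> a \<and> a \<le> 2 * ((b + 1) div 2) - 1" for a b
    by (auto simp: quartered_Kna_def aztec_diamond_iff ceiling_half)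
  moreover have "(a, b) \<in> stack (int n) (wall 2) (- 1) \<union> lev (- 1) {x. x mod 4 = 3 \<and> 1 \<le> x \<and> x \<le> int n} \<longleftrightarrow>
      - 1 < a + b \<and> a + b < int n \<and> wall 2 (a + b) \<le> b - a \<and> b - a \<le> int n \<or>
      a + b = - 1 \<and> (b - a) mod 4 = 3 \<and> 1 \<le> b - a \<and> b - a \<le> int n" for a b
    by (simp add: stack_def lev_def)
  ultimately show ?thesis
    by (intro equalityI subrelI) (simp_all only: iff)
qed

section \<open>Iterating the steps from the top diagonal to the bottom one\<close>

lemma wall_descent:
  shows "(c + \<phi>) mod 4 = 0 \<Longrightarrow> wall \<phi> c = 0 \<and> wall \<phi> (c - 1) = 1 \<and> wall \<phi> (c - 2) = 2"
    and "(c + \<phi>) mod 4 = 1 \<Longrightarrow> wall \<phi> c = 1 \<and> wall \<phi> (c - 1) = 0 \<and> wall \<phi> (c - 2) = 1"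
    and "(c + \<phi>) mod 4 = 2 \<Longrightarrow> wall \<phi> c = 2 \<and> wall \<phi> (c - 1) = 1 \<and> wall \<phi> (c - 2) = 0"
    and "(c + \<phi>) mod 4 = 3 \<Longrightarrow> wall \<phi> c = 1 \<and> wall \<phi> (c - 1) = 2 \<and> wall \<phi> (c - 2) = 1"
proof -
  have shift: "c - 1 + \<phi> = c + \<phi> - 1" "c - 2 + \<phi> = c + \<phi> - 2" by simp_all
  have "d mod 4 = 0 \<Longrightarrow> (d - 1) mod 4 = 3 \<and> (d - 2) mod 4 = 2"
    "d mod 4 = 1 \<Longrightarrow> (d - 1) mod 4 = 0 \<and> (d - 2) mod 4 = 3"
    "d mod 4 = 2 \<Longrightarrow> (d - 1) mod 4 = 1 \<and> (d - 2) mod 4 = 0"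
    "d mod 4 = 3 \<Longrightarrow> (d - 1) mod 4 = 2 \<and> (d - 2) mod 4 = 1" for d :: int
    by presburger+
  note mods = this[of "c + \<phi>"]
  show "wall \<phi> c = 0 \<and> wall \<phi> (c - 1) = 1 \<and> wall \<phi> (c - 2) = 2" if "(c + \<phi>) mod 4 = 0"
    unfolding wall_def shift using that mods(1)[OF that] by simp
  show "wall \<phi> c = 1 \<and> wall \<phi> (c - 1) = 0 \<and> wall \<phi> (c - 2) = 1" if "(c + \<phi>) mod 4 = 1"
    unfolding wall_def shift using that mods(2)[OF that] by simp
  show "wall \<phi> c = 2 \<and> wall \<phi> (c - 1) = 1 \<and> wall \<phi> (c - 2) = 0" if "(c + \<phi>) mod 4 = 2"
    unfolding wall_def shift using that mods(3)[OF that] by simp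
  show "wall \<phi> c = 1 \<and> wall \<phi> (c - 1) = 2 \<and> wall \<phi> (c - 2) = 1" if "(c + \<phi>) mod 4 = 3"
    unfolding wall_def shift using that mods(4)[OF that] by simp
qed

lemma even_iff_mod4:
  fixes c \<phi> :: int
  assumes "even \<phi>"
  shows "even c \<longleftrightarrow> (c + \<phi>) mod 4 = 0 \<or> (c + \<phi>) mod 4 = 2"
proof -
  define d where "d = c + \<phi>"
  have "even d \<longleftrightarrow> d mod 4 = 0 \<or> d mod 4 = 2" by presburger
  moreover have "even c \<longleftrightarrow> even d" using assms by (simp add: d_def)
  ultimately show ?thesis by (simp only: d_def)
qed

text \<open>At residues 0 and 3 the wall rises on the way down, which keeps \<open>m\<close> and
  turns \<open>e\<close> into 1; at 1 and 2 it falls and one particle is gained. Two levels lower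
  the residue by two, so both situations alternate in a cycle of four levels.\<close>

lemma wall_steps_even:
  assumes inv: "particle_inv n (wall \<phi>) c 0 m" and "0 \<le> n" "c < n" "odd (n + c)" "even \<phi>"
    and mod: "(c + \<phi>) mod 4 = 0 \<or> (c + \<phi>) mod 4 = 3"
  shows "hole_inv n (wall \<phi>) (c - 1) 1 m" "particle_inv n (wall \<phi>) (c - 2) 1 m"
proof -
  have w: "(c + \<phi>) mod 4 = 0 \<and> even c \<and> wall \<phi> c = 0 \<and> wall \<phi> (c - 1) = 1 \<and> wall \<phi> (c - 2) = 2 \<or>
      (c + \<phi>) mod 4 = 3 \<and> odd c \<and> wall \<phi> c = 1 \<and> wall \<phi> (c - 1) = 2 \<and> wall \<phi> (c - 2) = 1"
    using mod wall_descent(1)[of c \<phi>] wall_descent(4)[of c \<phi>] even_iff_mod4[OF \<open>even \<phi>\<close>, of c]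
    by (elim disjE) simp_all
  show *: "hole_inv n (wall \<phi>) (c - 1) 1 m"
    by (rule hole_step_keep[OF inv]) (use assms w in auto)
  have "particle_inv n (wall \<phi>) (c - 1 - 1) 1 m"
    by (rule particle_step[OF *]) (use assms w in auto)
  then show "particle_inv n (wall \<phi>) (c - 2) 1 m" by simp
qed

lemma wall_steps_odd:
  assumes inv: "particle_inv n (wall \<phi>) c 1 m" and "c < n" "odd (n + c)" "even \<phi>"
    and mod: "(c + \<phi>) mod 4 = 1 \<or> (c + \<phi>) mod 4 = 2"
  shows "hole_inv n (wall \<phi>) (c - 1) 0 (Suc m)" "particle_inv n (wall \<phi>) (c - 2) 0 (Suc m)"
proof -
  have w: "(c + \<phi>) mod 4 = 1 \<and> odd c \<and> wall \<phi> c = 1 \<and> wall \<phi> (c - 1) = 0 \<and> wall \<phi> (c - 2) = 1 \<or>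
      (c + \<phi>) mod 4 = 2 \<and> even c \<and> wall \<phi> c = 2 \<and> wall \<phi> (c - 1) = 1 \<and> wall \<phi> (c - 2) = 0"
    using mod wall_descent(2)[of c \<phi>] wall_descent(3)[of c \<phi>] even_iff_mod4[OF \<open>even \<phi>\<close>, of c]
    by (elim disjE) simp_all
  show *: "hole_inv n (wall \<phi>) (c - 1) 0 (Suc m)"
    by (rule hole_step_grow[OF inv]) (use assms w in auto)
  have "particle_inv n (wall \<phi>) (c - 1 - 1) 0 (Suc m)"
    by (rule particle_step[OF *]) (use assms w in auto)
  then show "particle_inv n (wall \<phi>) (c - 2) 0 (Suc m)" by simp
qed

text \<open>The residue of the top level \<open>n - 1\<close> decides which \<open>e\<close> to
  start with; each cycle of four levels restores \<open>e\<close> and adds one particle.\<close>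

lemma particle_inv_iterate_even:
  assumes "0 \<le> n" "even \<phi>" "(n - 1 + \<phi>) mod 4 = 0 \<or> (n - 1 + \<phi>) mod 4 = 3"
  shows "particle_inv n (wall \<phi>) (n - 1 - 4 * int k) 0 k"
proof (induction k)
  case 0
  then show ?case using particle_inv_top[of n "wall \<phi>" 0] by simp
next
  case (Suc k)
  let ?c = "n - 1 - 4 * int k"
  have "particle_inv n (wall \<phi>) (?c - 2) 1 k"
    by (rule wall_steps_even[OF Suc]) (use assms in \<open>simp_all, presburger\<close>)
  then have "particle_inv n (wall \<phi>) (?c - 2 - 2) 0 (Suc k)"
    by (rule wall_steps_odd) (use assms in \<open>simp_all, presburger\<close>)
  then show ?case by (simp add: algebra_simps)
qed

lemma particle_inv_iterate_odd:
  assumes "0 \<le> n" "even \<phi>" "(n - 1 + \<phi>) mod 4 = 1 \<or> (n - 1 + \<phi>) mod 4 = 2"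
  shows "particle_inv n (wall \<phi>) (n - 1 - 4 * int k) 1 k"
proof (induction k)
  case 0
  then show ?case using particle_inv_top[of n "wall \<phi>" 1] by simp
next
  case (Suc k)
  let ?c = "n - 1 - 4 * int k"
  have "particle_inv n (wall \<phi>) (?c - 2) 0 (Suc k)"
    by (rule wall_steps_odd[OF Suc]) (use assms in \<open>simp_all, presburger\<close>)
  then have "particle_inv n (wall \<phi>) (?c - 2 - 2) 1 (Suc k)"
    by (rule wall_steps_even) (use assms in \<open>simp_all, presburger\<close>)
  then show ?case by (simp add: algebra_simps)
qed

text \<open>One order needs \<open>k\<close> full cycles from \<open>e = 0\<close>, the other
  \<open>k - 1\<close> full cycles from \<open>e = 1\<close> and half a cycle more. That both end in
  the same invariant is why these two orders have equally many tilings.\<close>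

lemma particle_inv_bottom_0:
  assumes "n = 4 * int k \<or> n = 4 * int k - 2 \<and> 1 \<le> k"
  shows "particle_inv n (wall 0) (- 1) 0 k"
  using assms
proof
  assume n: "n = 4 * int k"
  then have "(n - 1 + 0) mod 4 = 3" by presburger
  then show ?thesis using particle_inv_iterate_even[of n 0 k] n by simp
next
  assume n: "n = 4 * int k - 2 \<and> 1 \<le> k"
  then obtain k' where k: "k = Suc k'" by (cases k) auto
  have "(n - 1 + 0) mod 4 = 1" using n by presburger
  then have "particle_inv n (wall 0) 1 1 k'"
    using particle_inv_iterate_odd[of n 0 k'] n k by simp
  then have "particle_inv n (wall 0) (1 - 2) 0 (Suc k')"
    by (rule wall_steps_odd) (use n k in auto)
  then show ?thesis by (simp add: k)
qed

text \<open>For odd \<open>n\<close> the bottom diagonal has the parity of \<open>n\<close> and is a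
  hole level, one interlacing step below the particle level 0.\<close>

lemma hole_inv_bottom_1:
  assumes "n = 4 * int k + 1 \<or> n = 4 * int k - 1 \<and> 1 \<le> k"
  shows "hole_inv n (wall 0) (- 1) 1 k"
proof -
  have "particle_inv n (wall 0) 0 0 k"
    using assms
  proof
    assume n: "n = 4 * int k + 1"
    then have "(n - 1 + 0) mod 4 = 0" by presburger
    then show ?thesis using particle_inv_iterate_even[of n 0 k] n by simp
  next
    assume n: "n = 4 * int k - 1 \<and> 1 \<le> k"
    then obtain k' where k: "k = Suc k'" by (cases k) auto
    have "(n - 1 + 0) mod 4 = 2" using n by presburger
    then have "particle_inv n (wall 0) 2 1 k'"
      using particle_inv_iterate_odd[of n 0 k'] n k by simp
    then have "particle_inv n (wall 0) (2 - 2) 0 (Suc k')"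
      by (rule wall_steps_odd) (use n k in auto)
    then show ?thesis by (simp add: k)
  qed
  then have "hole_inv n (wall 0) (0 - 1) 1 k"
    by (rule wall_steps_even) (use assms in auto)
  then show ?thesis by simp
qed

lemma particle_inv_bottom_1:
  assumes "n = 4 * int k \<or> n = 4 * int k + 2"
  shows "particle_inv n (wall 2) (- 1) 1 k"
  using assms
proof
  assume n: "n = 4 * int k"
  then have "(n - 1 + 2) mod 4 = 1" by presburger
  then show ?thesis using particle_inv_iterate_odd[of n 2 k] n by simp
next
  assume n: "n = 4 * int k + 2"
  then have "(n - 1 + 2) mod 4 = 3" by presburger
  then have "particle_inv n (wall 2) 1 0 k"
    using particle_inv_iterate_even[of n 2 k] n by simp
  then have "particle_inv n (wall 2) (1 - 2) 1 k"
    by (rule wall_steps_even) (use n in auto)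
  then show ?thesis by simp
qed

lemma hole_inv_bottom_0:
  assumes "n = 4 * int k + 1 \<or> n = 4 * int k + 3"
  shows "hole_inv n (wall 2) (- 1) 0 (Suc k)"
proof -
  have "particle_inv n (wall 2) 0 1 k"
    using assms
  proof
    assume n: "n = 4 * int k + 1"
    then have "(n - 1 + 2) mod 4 = 2" by presburger
    then show ?thesis using particle_inv_iterate_odd[of n 2 k] n by simp
  next
    assume n: "n = 4 * int k + 3"
    then have "(n - 1 + 2) mod 4 = 0" by presburger
    then have "particle_inv n (wall 2) 2 0 k"
      using particle_inv_iterate_even[of n 2 k] n by simp
    then have "particle_inv n (wall 2) (2 - 2) 1 k"
      by (rule wall_steps_even) (use n in auto)
    then show ?thesis by simp
  qed
  then have "hole_inv n (wall 2) (0 - 1) 0 (Suc k)"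
    by (rule wall_steps_odd) (use assms in auto)
  then show ?thesis by simp
qed

section \<open>Evaluation at the prescribed bottom configuration\<close>

lemma residue_class_mod4:
  assumes r: "r = 1 \<or> r = 3" and n: "4 * int k + r - 4 \<le> n" "n < 4 * int k + r"
  shows "{x. x mod 4 = r \<and> 1 \<le> x \<and> x \<le> n} = (\<lambda>i. 4 * int i + r) ` {..<k}"
proof (intro equalityI subsetI)
  fix x assume "x \<in> {x. x mod 4 = r \<and> 1 \<le> x \<and> x \<le> n}"
  then have x: "x mod 4 = r" "1 \<le> x" "x \<le> n" by auto
  have div: "x = 4 * (x div 4) + r" using x(1) by presburger
  show "x \<in> (\<lambda>i. 4 * int i + r) ` {..<k}"
  proof (rule image_eqI)
    have "0 \<le> x div 4" using x(2) by simp
    then show "x = 4 * int (nat (x div 4)) + r" using div by simp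
    show "nat (x div 4) \<in> {..<k}" using div x(3) n(2) \<open>0 \<le> x div 4\<close> by auto
  qed
qed (use r n in auto)

lemma valid_mod4:
  assumes "r = 1 \<or> r = 3" "4 * int k + r - 4 \<le> n" "w (- 1) \<le> 1"
  shows "valid n w (- 1) k (\<lambda>i. 4 * int i + r)"
  using assms by (auto simp: valid_def)

lemma num_tilings_particles:
  assumes inv: "particle_inv n (wall \<phi>) (- 1) e k" and r: "r = 1 \<or> r = 3"
    and n: "4 * int k + r - 4 \<le> n" "n < 4 * int k + r" and \<phi>: "wall \<phi> (- 1) = 1"
  shows "real (num_tilings (stack n (wall \<phi>) (- 1) \<union> lev (- 1) {x. x mod 4 = r \<and> 1 \<le> x \<and> x \<le> n})) =
    2 ^ k * coef e k * alternant k e (\<lambda>i. 4 * int i + r)"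
proof -
  \<comment> \<open>The prescribed positions are positive, so no particle carries the weight
    1/2.\<close>
  have "(\<Prod>i<k. wall_weight e (4 * int i + r)) = 1"
    using r by (intro prod.neutral) (auto simp: wall_weight_def)
  then show ?thesis
    using inv valid_mod4[OF r n(1), of "wall \<phi>"] \<phi> unfolding residue_class_mod4[OF r n] particle_inv_def
    by simp
qed

text \<open>Positions on diagonal -1 are odd, so keeping one residue class mod 4 means having the
  holes at the other.\<close>

lemma num_tilings_holes:
  assumes inv: "hole_inv n (wall \<phi>) (- 1) e k" and r: "r = 1 \<or> r = 3"
    and n: "4 * int k + r - 4 \<le> n" "n < 4 * int k + r" and \<phi>: "wall \<phi> (- 1) = 1"
  shows "real (num_tilings (stack n (wall \<phi>) (- 1) \<union> lev (- 1) {x. x mod 4 = 4 - r \<and> 1 \<le> x \<and> x \<le> n})) =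
    coef e k * alternant k e (\<lambda>i. 4 * int i + r)"
proof -
  have "lev (- 1) {x. x mod 4 = 4 - r \<and> 1 \<le> x \<and> x \<le> n} =
      lev (- 1) ({1..n} - {x. x mod 4 = r \<and> 1 \<le> x \<and> x \<le> n})"
  proof (rule lev_cong)
    fix x :: int assume "even (- 1 + x)"
    with r have "x mod 4 = 4 - r \<longleftrightarrow> x mod 4 \<noteq> r" by presburger
    then show "x \<in> {x. x mod 4 = 4 - r \<and> 1 \<le> x \<and> x \<le> n} \<longleftrightarrow>
      x \<in> {1..n} - {x. x mod 4 = r \<and> 1 \<le> x \<and> x \<le> n}" by auto
  qed
  then show ?thesis
    using inv valid_mod4[OF r n(1), of "wall \<phi>"] \<phi> unfolding residue_class_mod4[OF r n] hole_inv_def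
    by simp
qed

lemma wall_bottom: "wall 0 (- 1) = 1" "wall 2 (- 1) = 1"
  by (simp_all add: wall_def)

lemma num_tilings_swap: "num_tilings (prod.swap ` X) = num_tilings X"
proof -
  have domino: "domino (prod.swap ` d)" if "domino d" for d
    using that unfolding domino_def by (auto, blast+)
  have tiling: "domino_tiling (prod.swap ` Y) ((`) prod.swap ` D)" if "domino_tiling Y D" for Y D
  proof -
    have "disjoint ((`) prod.swap ` D)"
      using that by (intro disjoint_image) (auto simp: domino_tiling_def inj_on_def)
    then show ?thesis using that domino by (auto simp: domino_tiling_def)
  qed
  have "bij_betw ((`) ((`) prod.swap)) {D. domino_tiling X D} {D. domino_tiling (prod.swap ` X) D}"
    by (rule bij_betw_byWitness[where f' = "(`) ((`) prod.swap)"])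
      (use tiling[of X] tiling[of "prod.swap ` X"] in \<open>auto simp: image_image\<close>)
  then show ?thesis unfolding num_tilings_def by (rule bij_betw_same_card[symmetric])
qed

lemma num_tilings_Ka_even:
  assumes "n = 4 * k \<or> n = 4 * k - 2 \<and> 1 \<le> k"
  shows "real (num_tilings (quartered_Ka n)) = 2 ^ k * (coef 0 k * alternant k 0 (\<lambda>i. 4 * int i + 1))"
  unfolding quartered_Ka_eq
  by (subst num_tilings_particles[where k = k, OF particle_inv_bottom_0]) (use assms wall_bottom in auto)

lemma num_tilings_Ka_odd:
  assumes "n = 4 * k + 1 \<or> n = 4 * k - 1 \<and> 1 \<le> k"
  shows "real (num_tilings (quartered_Ka n)) = coef 1 k * alternant k 1 (\<lambda>i. 4 * int i + 3)"
  unfolding quartered_Ka_eq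
  using num_tilings_holes[where k = k and r = 3, OF hole_inv_bottom_1, of "int n"] assms wall_bottom by auto

lemma num_tilings_R_even:
  "real (num_tilings (quartered_R (4 * k))) = 2 ^ k * (coef 0 k * alternant k 0 (\<lambda>i. 4 * int i + 3))"
  unfolding quartered_R_eq
  by (subst num_tilings_particles[where k = k, OF particle_inv_bottom_0]) (use wall_bottom in auto)

lemma num_tilings_R_odd:
  assumes "1 \<le> k"
  shows "real (num_tilings (quartered_R (4 * k - 1))) = coef 1 k * alternant k 1 (\<lambda>i. 4 * int i + 1)"
  unfolding quartered_R_eq
  using num_tilings_holes[where k = k and r = 1, OF hole_inv_bottom_1, of "int (4 * k - 1)"] assms wall_bottom
  by auto

lemma num_tilings_Kna_even:
  assumes "n = 4 * k \<or> n = 4 * k + 2"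
  shows "real (num_tilings (quartered_Kna n)) = 2 ^ k * (coef 1 k * alternant k 1 (\<lambda>i. 4 * int i + 3))"
  unfolding num_tilings_swap[of "quartered_Kna n", symmetric] swap_quartered_Kna_eq
  by (subst num_tilings_particles[where k = k, OF particle_inv_bottom_1]) (use assms wall_bottom in auto)

lemma num_tilings_Kna_odd:
  assumes "n = 4 * k - 3 \<or> n = 4 * k - 1" "1 \<le> k"
  shows "real (num_tilings (quartered_Kna n)) = coef 0 k * alternant k 0 (\<lambda>i. 4 * int i + 1)"
proof -
  \<comment> \<open>The orders become \<open>4 * k' + 1\<close> and \<open>4 * k' + 3\<close>, the
    form in which the invariant is available.\<close>
  obtain k' where k: "k = Suc k'" using assms(2) by (cases k) auto
  show ?thesis
    unfolding num_tilings_swap[of "quartered_Kna n", symmetric] swap_quartered_Kna_eq k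
    using num_tilings_holes[where k = "Suc k'" and r = 1, OF hole_inv_bottom_0, of "int n"] assms k wall_bottom
    by auto
qed

section \<open>Evaluation of the products\<close>

lemma prod_pairs_lt:
  "(\<Prod>(i, j)\<in>pairs_lt n. f i j) = (\<Prod>j<n. \<Prod>i<j. f (Suc i) (Suc j))"
proof -
  have "(\<Prod>j<n. \<Prod>i<j. f (Suc i) (Suc j)) = (\<Prod>(j, i)\<in>(SIGMA j:{..<n}. {..<j}). f (Suc i) (Suc j))"
    by (rule prod.Sigma) auto
  also have "\<dots> = (\<Prod>(i, j)\<in>pairs_lt n. f i j)"
    by (rule prod.reindex_bij_witness[of _ "\<lambda>(i, j). (j - 1, i - 1)" "\<lambda>(j, i). (Suc i, Suc j)"])
      (auto simp: pairs_lt_def)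
  finally show ?thesis ..
qed

lemma prod_pairs_le:
  "(\<Prod>(i, j)\<in>pairs_le n. f i j) = (\<Prod>(i, j)\<in>pairs_lt n. f i j) * (\<Prod>i<n. f (Suc i) (Suc i))"
proof -
  have eq: "pairs_le n = pairs_lt n \<union> (\<lambda>i. (Suc i, Suc i)) ` {..<n}"
  proof (intro equalityI subrelI)
    fix i j assume "(i, j) \<in> pairs_le n"
    then show "(i, j) \<in> pairs_lt n \<union> (\<lambda>i. (Suc i, Suc i)) ` {..<n}"
      by (cases "i = j"; cases i) (auto simp: pairs_le_def pairs_lt_def image_iff)
  qed (auto simp: pairs_le_def pairs_lt_def)
  have "finite (pairs_lt n)"
    by (rule finite_subset[of _ "{..n} \<times> {..n}"]) (auto simp: pairs_lt_def)
  moreover have "pairs_lt n \<inter> (\<lambda>i. (Suc i, Suc i)) ` {..<n} = {}" by (auto simp: pairs_lt_def)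
  moreover have "(\<Prod>(i, j)\<in>(\<lambda>i. (Suc i, Suc i)) ` {..<n}. f i j) = (\<Prod>i<n. f (Suc i) (Suc i))"
    by (subst prod.reindex) (auto simp: inj_on_def)
  ultimately show ?thesis unfolding eq by (simp add: prod.union_disjoint)
qed

text \<open>The differences multiply to \<open>fact j\<close>, the sums to
  \<open>fact (2 * j) / fact j\<close>.\<close>

lemma prod_differences_sums_fact:
  "(\<Prod>i<j. (real j - real i) * (real i + real j + 1)) = fact (2 * j)"
proof -
  have "(\<Prod>i<j. real j - real i) = (\<Prod>i<j. real (Suc i))"
    by (subst prod.nat_diff_reindex[symmetric]) (auto intro!: prod.cong simp: of_nat_diff)
  moreover have "(\<Prod>i<m. real (Suc i)) = fact m" for m
    by (induction m) (simp_all add: mult.commute)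
  moreover have "fact j * (\<Prod>i<m. real i + real j + 1) = fact (j + m)" for m
  proof (induction m)
    case (Suc m)
    have "fact (j + Suc m) = fact (j + m) * (real m + real j + 1)" by (simp add: algebra_simps)
    then show ?case by (simp only: prod.lessThan_Suc mult.assoc[symmetric] Suc.IH)
  qed simp
  ultimately show ?thesis by (simp add: prod.distrib mult_2)
qed

text \<open>Truncated subtraction is harmless, since for \<open>k = 0\<close> the other factor is 0.
  The numerator grows by an even number, which passes through \<open>div\<close>.\<close>

lemma exponent_Suc: "Suc k * (3 * Suc k - 3) div 2 = k * (3 * k - 3) div 2 + 3 * k"
proof -
  have "Suc k * (3 * Suc k - 3) = k * (3 * k - 3) + 2 * (3 * k)"
    by (cases k) (simp_all add: algebra_simps)
  then show ?thesis by simp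
qed

lemma exponent_shift: "(k::nat) * (3 * k - 1) div 2 = k + k * (3 * k - 3) div 2"
proof -
  have "k * (3 * k - 1) = k * (3 * k - 3) + 2 * k"
    by (cases k) (simp_all add: algebra_simps)
  then show ?thesis by simp
qed

text \<open>A new entry \<open>4 * k + r\<close> contributes its differences of squares,
  \<open>8 * (k - i) * (2 * i + 2 * k + r)\<close>, divided by \<open>fact (2 * k)\<close>. The
  factorial cancels against \<open>k - i\<close> and leaves the denominators
  \<open>i + k + 1\<close>.\<close>

lemma coef_alternant_even:
  "coef 0 k * alternant k 0 (\<lambda>i. 4 * int i + int r) =
    2 ^ (k * (3 * k - 3) div 2) *
    (\<Prod>(i, j)\<in>pairs_lt k. (2 * real i + 2 * real j + real r - 4) / (real i + real j - 1))"
proof (induction k)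
  case 0
  then show ?case by (simp add: coef_def alternant_eq_prod prod_pairs_lt)
next
  case (Suc k)
  let ?x = "\<lambda>i. 4 * int i + int r"
  have factor: "(\<Prod>i<k. real_of_int (?x k) ^ 2 - real_of_int (?x i) ^ 2) =
      2 ^ (3 * k) * fact (2 * k) * (\<Prod>i<k. (2 * real i + 2 * real k + real r) / (real i + real k + 1))"
  proof -
    \<comment> \<open>\<open>A\<close> gathers the factors whose product is the factorial,
      \<open>B\<close> is what remains for the product formula.\<close>
    define A B where "A i = (real k - real i) * (real i + real k + 1)"
      and "B i = (2 * real i + 2 * real k + real r) / (real i + real k + 1)" for i
    have "real_of_int (?x k) ^ 2 - real_of_int (?x i) ^ 2 = 2 ^ 3 * A i * B i" for i
    proof -
      have "real i + real k + 1 \<noteq> 0" by linarith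
      then have "2 ^ 3 * A i * B i = 2 ^ 3 * (real k - real i) * (2 * real i + 2 * real k + real r)"
        by (simp add: A_def B_def)
      then show ?thesis by (simp add: power2_eq_square algebra_simps)
    qed
    moreover have "(\<Prod>i<k. A i) = fact (2 * k)"
      unfolding A_def by (rule prod_differences_sums_fact)
    ultimately have "(\<Prod>i<k. real_of_int (?x k) ^ 2 - real_of_int (?x i) ^ 2) =
        2 ^ (3 * k) * fact (2 * k) * (\<Prod>i<k. B i)"
      by (simp add: prod.distrib power_mult)
    then show ?thesis by (simp add: B_def)
  qed
  have "coef 0 (Suc k) * alternant (Suc k) 0 ?x =
      coef 0 k * alternant k 0 ?x * ((\<Prod>i<k. real_of_int (?x k) ^ 2 - real_of_int (?x i) ^ 2) / fact (2 * k))"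
    unfolding coef_def alternant_eq_prod by (simp add: field_simps)
  also have "(\<Prod>i<k. real_of_int (?x k) ^ 2 - real_of_int (?x i) ^ 2) / fact (2 * k) =
      2 ^ (3 * k) * (\<Prod>i<k. (2 * real i + 2 * real k + real r) / (real i + real k + 1))"
    unfolding factor by simp
  finally show ?case
    unfolding Suc.IH prod_pairs_lt exponent_Suc
    by (simp add: power_add algebra_simps)
qed

lemma coef_alternant_odd:
  "coef 1 k * alternant k 1 x =
    coef 0 k * alternant k 0 x * (\<Prod>i<k. real_of_int (x i) / (2 * real i + 1))"
  unfolding coef_def alternant_eq_prod by (simp add: prod_dividef algebra_simps)

text \<open>Compared with \<open>e = 0\<close> each row brings an extra
  \<open>(4 * i + 3) / (2 * i + 1)\<close>, which is the diagonal factor at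
  \<open>(Suc i, Suc i)\<close>; hence pairs with equal entries join the product.\<close>

lemma coef_alternant_odd_3:
  "coef 1 k * alternant k 1 (\<lambda>i. 4 * int i + 3) =
    2 ^ (k * (3 * k - 3) div 2) *
    (\<Prod>(i, j)\<in>pairs_le k. (2 * real i + 2 * real j - 1) / (real i + real j - 1))"
proof -
  have "(\<Prod>i<k. real_of_int (4 * int i + 3) / (2 * real i + 1)) =
      (\<Prod>i<k. (2 * real (Suc i) + 2 * real (Suc i) - 1) / (real (Suc i) + real (Suc i) - 1))"
    by (intro prod.cong) (simp_all add: algebra_simps)
  then show ?thesis
    using coef_alternant_even[of k 3] unfolding coef_alternant_odd prod_pairs_le by simp
qed

text \<open>For a fixed larger index the quotients of the two pair products telescope to
  \<open>(4 * k + 1) / (2 * k + 1)\<close>, the factor by which \<open>e = 1\<close> differs from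
  \<open>e = 0\<close> at the entry \<open>4 * k + 1\<close>.\<close>

lemma coef_alternant_3_eq_1:
  "coef 0 k * alternant k 0 (\<lambda>i. 4 * int i + 3) = coef 1 k * alternant k 1 (\<lambda>i. 4 * int i + 1)"
proof -
  have telescope: "(\<Prod>i<m. (2 * real i + 2 * real k + 3) / (2 * real i + 2 * real k + 1)) =
      (2 * real m + 2 * real k + 1) / (2 * real k + 1)" for m k
  proof (induction m)
    case (Suc m)
    have "2 * real m + 2 * real k + 1 \<noteq> 0" "2 * real k + 1 \<noteq> 0" by linarith+
    with Suc show ?case by (simp add: field_simps)
  qed (simp add: field_simps)
  have "(\<Prod>(i, j)\<in>pairs_lt k. (2 * real i + 2 * real j - 1) / (real i + real j - 1)) =
      (\<Prod>(i, j)\<in>pairs_lt k. (2 * real i + 2 * real j - 3) / (real i + real j - 1)) *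
      (\<Prod>i<k. real_of_int (4 * int i + 1) / (2 * real i + 1))"
    unfolding prod_pairs_lt
  proof (induction k)
    case (Suc k)
    have "(\<Prod>i<k. (2 * real (Suc i) + 2 * real (Suc k) - 1) / (real (Suc i) + real (Suc k) - 1)) =
        (\<Prod>i<k. (2 * real (Suc i) + 2 * real (Suc k) - 3) / (real (Suc i) + real (Suc k) - 1) *
          ((2 * real i + 2 * real k + 3) / (2 * real i + 2 * real k + 1)))"
    proof (intro prod.cong refl)
      fix i
      have "2 * real i + 2 * real k + 1 \<noteq> 0" by linarith
      moreover have "2 * real (Suc i) + 2 * real (Suc k) - 3 = 2 * real i + 2 * real k + 1"
        "2 * real (Suc i) + 2 * real (Suc k) - 1 = 2 * real i + 2 * real k + 3" by simp_all
      moreover have "p / q = d / q * (p / d)" if "d \<noteq> 0" for p q d :: real using that by simp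
      ultimately show "(2 * real (Suc i) + 2 * real (Suc k) - 1) / (real (Suc i) + real (Suc k) - 1) =
          (2 * real (Suc i) + 2 * real (Suc k) - 3) / (real (Suc i) + real (Suc k) - 1) *
          ((2 * real i + 2 * real k + 3) / (2 * real i + 2 * real k + 1))" by metis
    qed
    also have "\<dots> = (\<Prod>i<k. (2 * real (Suc i) + 2 * real (Suc k) - 3) / (real (Suc i) + real (Suc k) - 1)) *
        (real_of_int (4 * int k + 1) / (2 * real k + 1))"
      unfolding prod.distrib telescope by simp
    finally show ?case
      unfolding prod.lessThan_Suc Suc.IH by (simp only: mult_ac)
  qed simp
  then show ?thesis
    using coef_alternant_even[of k 3] coef_alternant_even[of k 1] unfolding coef_alternant_odd by simp
qed

section \<open>Orders without tilings, by a colouring argument\<close>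

lemma prod_pairs_pos:
  "0 < (\<Prod>(i, j)\<in>pairs_lt k. (2 * real i + 2 * real j - 3) / (real i + real j - 1))"
  "0 < (\<Prod>(i, j)\<in>pairs_le k. (2 * real i + 2 * real j - 1) / (real i + real j - 1))"
  by (auto intro!: prod_pos simp: pairs_lt_def pairs_le_def)

text \<open>Chessboard colouring by the parity of the diagonal: the two cells of a domino have
  opposite signs.\<close>

lemma tileable_imp_balanced:
  assumes "finite X" "num_tilings X \<noteq> 0"
  shows "(\<Sum>(a, b)\<in>X. (- 1) ^ nat \<bar>a + b\<bar>) = (0 :: int)"
proof -
  obtain D where D: "domino_tiling X D"
    using assms(2) unfolding num_tilings_def by (metis (mono_tags) card.empty empty_Collect_eq)
  then have X: "X = \<Union>D" and dom: "\<And>d. d \<in> D \<Longrightarrow> domino d" by (auto simp: domino_tiling_def)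
  have alt: "(- 1 :: int) ^ nat \<bar>c + 1\<bar> = - ((- 1) ^ nat \<bar>c\<bar>)" for c :: int
    by (auto simp: minus_one_power_iff even_nat_iff)
  have "(\<Sum>(a, b)\<in>d. (- 1) ^ nat \<bar>a + b\<bar>) = (0 :: int)" if d: "d \<in> D" for d
  proof -
    obtain a b where "d = {(a, b), (a + 1, b)} \<or> d = {(a, b), (a, b + 1)}"
      using dom[OF d] by (auto simp: domino_def)
    then show ?thesis using alt[of "a + b"] by (auto simp: add_ac)
  qed
  moreover have "(\<Sum>x\<in>\<Union>D. case x of (a, b) \<Rightarrow> (- 1) ^ nat \<bar>a + b\<bar>) =
      (sum \<circ> sum) (\<lambda>(a, b). (- 1) ^ nat \<bar>a + b\<bar> :: int) D"
  proof (rule sum.Union_disjoint)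
    show "\<forall>A\<in>D. finite A" using dom by (auto simp: domino_def)
    show "\<forall>A\<in>D. \<forall>B\<in>D. A \<noteq> B \<longrightarrow> A \<inter> B = {}" using D by (auto simp: domino_tiling_def disjoint_def)
  qed
  ultimately show ?thesis unfolding X by simp
qed

lemma card_lev:
  assumes "\<And>x. x \<in> A \<Longrightarrow> even (c + x)"
  shows "card (lev c A) = card A"
proof -
  have "bij_betw (\<lambda>(a, b). b - a) (lev c A) A"
  proof (rule bij_betw_byWitness[where f' = "\<lambda>x. ((c - x) div 2, (c + x) div 2)"])
    have "(c - x) div 2 + (c + x) div 2 = c" "(c + x) div 2 - (c - x) div 2 = x" if "even (c + x)" for x
      using that by presburger+
    then show "\<forall>x\<in>A. (case ((c - x) div 2, (c + x) div 2) of (a, b) \<Rightarrow> b - a) = x"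
      "(\<lambda>x. ((c - x) div 2, (c + x) div 2)) ` A \<subseteq> lev c A"
      using assms by (auto simp: lev_def)
  qed (auto simp: lev_def)
  then show ?thesis by (rule bij_betw_same_card)
qed

text \<open>\<open>R\<close> and \<open>K_a\<close> share all cells above diagonal -1, so tilings of
  both would force equally many cells on that diagonal. For these orders \<open>K_a\<close> is
  tileable and has \<open>k + 1\<close> cells there, while \<open>R\<close> has
  \<open>k\<close>.\<close>

lemma num_tilings_R_zero:
  assumes "n = 4 * k + 1 \<or> n = 4 * k + 2"
  shows "num_tilings (quartered_R n) = 0"
proof (rule ccontr)
  assume R: "num_tilings (quartered_R n) \<noteq> 0"
  let ?Y = "stack (int n) (wall 0) (- 1)"
  let ?A = "\<lambda>r. {x. x mod 4 = r \<and> 1 \<le> x \<and> x \<le> int n}"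
  \<comment> \<open>The product formula for \<open>K_a\<close> is positive, so no tiling needs to be
    exhibited.\<close>
  have "0 < real (num_tilings (quartered_Ka n))"
    using assms
  proof
    assume "n = 4 * k + 1"
    then have "real (num_tilings (quartered_Ka n)) = coef 1 k * alternant k 1 (\<lambda>i. 4 * int i + 3)"
      by (intro num_tilings_Ka_odd) simp
    then show ?thesis
      unfolding coef_alternant_odd_3 using prod_pairs_pos(2)[of k] by simp
  next
    assume n: "n = 4 * k + 2"
    then have "real (num_tilings (quartered_Ka n)) =
        2 ^ Suc k * (coef 0 (Suc k) * alternant (Suc k) 0 (\<lambda>i. 4 * int i + int 1))"
      using num_tilings_Ka_even[of n "Suc k"] by simp
    then show ?thesis
      unfolding coef_alternant_even using prod_pairs_pos(1)[of "Suc k"] by simp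
  qed
  then have Ka: "num_tilings (quartered_Ka n) \<noteq> 0" by simp
  have fin: "finite ?Y" using above_stack[of "- 1" "int n" "wall 0"] by (simp add: above_def)
  have finA: "finite (?A r)" for r by (rule finite_subset[of _ "{1..int n}"]) auto
  \<comment> \<open>All \<open>m\<close> cells of diagonal -1 have sign -1, so in a tileable region
    the shared part has colour excess \<open>m\<close>.\<close>
  have count: "(\<Sum>(a, b)\<in>?Y. (- 1) ^ nat \<bar>a + b\<bar>) = int m"
    if "num_tilings (?Y \<union> lev (- 1) (?A r)) \<noteq> 0" "r = 1 \<or> r = 3"
      "4 * int m + r - 4 \<le> int n" "int n < 4 * int m + r" for r m
  proof -
    have "card (lev (- 1) (?A r)) = card (?A r)"
      by (rule card_lev) (use that(2) in \<open>auto, presburger+\<close>)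
    also have "\<dots> = m"
      unfolding residue_class_mod4[OF that(2-4)] by (subst card_image) (auto simp: inj_on_def)
    finally have "(\<Sum>(a, b)\<in>lev (- 1) (?A r). (- 1) ^ nat \<bar>a + b\<bar>) = - int m"
      by (simp add: lev_def case_prod_unfold)
    moreover have "(\<Sum>(a, b)\<in>?Y \<union> lev (- 1) (?A r). (- 1) ^ nat \<bar>a + b\<bar>) = (0 :: int)"
      by (rule tileable_imp_balanced) (use fin finA that in auto)
    ultimately show ?thesis
      using sum.union_disjoint[OF fin finite_lev[OF finA] stack_Int_lev, of "\<lambda>(a, b). (- 1 :: int) ^ nat \<bar>a + b\<bar>" r]
      by simp
  qed
  have "int (Suc k) = int k"
    using count[of 1 "Suc k"] count[of 3 k] Ka R assms unfolding quartered_Ka_eq quartered_R_eq by auto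
  then show False by simp
qed

theorem theorem1:
  shows "(\<forall>n::nat. num_tilings (quartered_R (4 * n + 1)) = 0 \<and> num_tilings (quartered_R (4 * n + 2)) = 0) \<and>
    (\<forall>n::nat. n \<ge> 1 \<longrightarrow>
      (num_tilings (quartered_R (4 * n)) = 2 ^ n * num_tilings (quartered_R (4 * n - 1)) \<and>
       real (num_tilings (quartered_R (4 * n))) =
         2 ^ (n * (3 * n - 1) div 2) * (\<Prod>(i, j)\<in>pairs_lt n. (2 * real i + 2 * real j - 1) / (real i + real j - 1))) \<and>
      (num_tilings (quartered_Ka (4 * n - 2)) = num_tilings (quartered_Ka (4 * n)) \<and>
       real (num_tilings (quartered_Ka (4 * n))) =
         2 ^ (n * (3 * n - 1) div 2) * (\<Prod>(i, j)\<in>pairs_lt n. (2 * real i + 2 * real j - 3) / (real i + real j - 1))) \<and>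
      (num_tilings (quartered_Ka (4 * n - 1)) = num_tilings (quartered_Ka (4 * n + 1)) \<and>
       real (num_tilings (quartered_Ka (4 * n + 1))) =
         2 ^ (n * (3 * n - 3) div 2) * (\<Prod>(i, j)\<in>pairs_le n. (2 * real i + 2 * real j - 1) / (real i + real j - 1))) \<and>
      (num_tilings (quartered_Kna (4 * n)) = num_tilings (quartered_Kna (4 * n + 2)) \<and>
       real (num_tilings (quartered_Kna (4 * n + 2))) =
         2 ^ (n * (3 * n - 1) div 2) * (\<Prod>(i, j)\<in>pairs_le n. (2 * real i + 2 * real j - 1) / (real i + real j - 1))) \<and>
      (num_tilings (quartered_Kna (4 * n - 3)) = num_tilings (quartered_Kna (4 * n - 1)) \<and>
       real (num_tilings (quartered_Kna (4 * n - 1))) =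
         2 ^ (n * (3 * n - 3) div 2) * (\<Prod>(i, j)\<in>pairs_lt n. (2 * real i + 2 * real j - 3) / (real i + real j - 1))))"
proof (intro conjI allI impI)
  fix n :: nat
  show "num_tilings (quartered_R (4 * n + 1)) = 0" "num_tilings (quartered_R (4 * n + 2)) = 0"
    using num_tilings_R_zero by blast+
next
  fix n :: nat assume n: "1 \<le> n"
  have eq: "x = y" if "real x = v" "real y = v" for x y v
    using that by simp
  note even_1 = coef_alternant_even[of n 1, simplified] and even_3 = coef_alternant_even[of n 3, simplified]
  \<comment> \<open>The alternant expressions of both orders coincide; \<open>2 ^ n\<close> remains
    because order \<open>4 * n\<close> ends on a particle level.\<close>
  have "real (num_tilings (quartered_R (4 * n))) = real (2 ^ n * num_tilings (quartered_R (4 * n - 1)))"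
    by (simp only: of_nat_mult of_nat_power of_nat_numeral num_tilings_R_even num_tilings_R_odd[OF n]
        coef_alternant_3_eq_1)
  then show "num_tilings (quartered_R (4 * n)) = 2 ^ n * num_tilings (quartered_R (4 * n - 1))"
    by (simp only: of_nat_eq_iff)
  show "real (num_tilings (quartered_R (4 * n))) =
      2 ^ (n * (3 * n - 1) div 2) * (\<Prod>(i, j)\<in>pairs_lt n. (2 * real i + 2 * real j - 1) / (real i + real j - 1))"
    unfolding num_tilings_R_even exponent_shift even_3 by (simp add: power_add)
  show "num_tilings (quartered_Ka (4 * n - 2)) = num_tilings (quartered_Ka (4 * n))"
    by (rule eq[OF num_tilings_Ka_even num_tilings_Ka_even]) (use n in auto)
  show "real (num_tilings (quartered_Ka (4 * n))) =
      2 ^ (n * (3 * n - 1) div 2) * (\<Prod>(i, j)\<in>pairs_lt n. (2 * real i + 2 * real j - 3) / (real i + real j - 1))"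
    unfolding num_tilings_Ka_even[OF disjI1[OF refl]] exponent_shift even_1 by (simp add: power_add)
  show "num_tilings (quartered_Ka (4 * n - 1)) = num_tilings (quartered_Ka (4 * n + 1))"
    by (rule eq[OF num_tilings_Ka_odd num_tilings_Ka_odd]) (use n in auto)
  show "real (num_tilings (quartered_Ka (4 * n + 1))) =
      2 ^ (n * (3 * n - 3) div 2) * (\<Prod>(i, j)\<in>pairs_le n. (2 * real i + 2 * real j - 1) / (real i + real j - 1))"
    unfolding num_tilings_Ka_odd[OF disjI1[OF refl]] coef_alternant_odd_3 ..
  show "num_tilings (quartered_Kna (4 * n)) = num_tilings (quartered_Kna (4 * n + 2))"
    by (rule eq[OF num_tilings_Kna_even num_tilings_Kna_even]) auto
  show "real (num_tilings (quartered_Kna (4 * n + 2))) =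
      2 ^ (n * (3 * n - 1) div 2) * (\<Prod>(i, j)\<in>pairs_le n. (2 * real i + 2 * real j - 1) / (real i + real j - 1))"
    unfolding num_tilings_Kna_even[OF disjI2[OF refl]] exponent_shift coef_alternant_odd_3
    by (simp add: power_add)
  show "num_tilings (quartered_Kna (4 * n - 3)) = num_tilings (quartered_Kna (4 * n - 1))"
    by (rule eq[OF num_tilings_Kna_odd num_tilings_Kna_odd]) (use n in auto)
  show "real (num_tilings (quartered_Kna (4 * n - 1))) =
      2 ^ (n * (3 * n - 3) div 2) * (\<Prod>(i, j)\<in>pairs_lt n. (2 * real i + 2 * real j - 3) / (real i + real j - 1))"
    unfolding num_tilings_Kna_odd[OF disjI2[OF refl] n] even_1 ..
qed

end
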